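(* Let $\Gamma$ be a connected Dynkin diagram of finite Lie type and let $P$ be a connected finite $\Gamma$-colored minuscule poset; let $j\in\Gamma$ be the color of the unique maximal element of $P$. For $x\in P$ let $F_x$ be the filter of $P$ generated by $x$ and $w_x\in W$ the Weyl group element determined by $F_x$. Let $\Phi_j^\vee$ be the filter of $(\Phi^\vee)^+$ generated by $\alpha_j^\vee$; its unique maximal element is the highest coroot of $\Phi^\vee$. Then: (a) For all $x\in P$, $F_x$ is dual isomorphic as an uncolored poset to $\Phi^\vee(w_x)$, and $\Phi^\vee(w_x)$ is an order ideal of $\Phi_j^\vee$ generated by a single element, denoted $\gamma_x^\vee$. (b) If $x$ is the unique minimal element of $P$, then $\Phi^\vee(w_x)=\Phi_j^\vee$ and $w_x$ is the longest element $w_0^{\langle j\rangle}$ of $W^{\langle j\rangle}$. (c) The map $\psi:P\to\Phi_j^\vee$, $\psi(x)=\gamma_x^\vee$, is a dual isomorphism of uncolored posets. (d) Defining $\kappa_\psi:\Phi_j^\vee\to\Gamma$ by $\kappa_\psi(\gamma_x^\vee)=\kappa(x)$, the posets $P$ and $\Phi_j^\vee$ are dual isomorphic as $\Gamma$-colored posets; hence $\Phi_j^\vee$ with coloring $\kappa_\psi$ is $\Gamma$-colored minuscule.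
   Context: A Dynkin diagram $\Gamma$: finite set with integers $\theta_{ab}$, $\theta_{aa}=2$, $\theta_{ab}\le0$ ($a\ne b$), $\theta_{ab}=0\iff\theta_{ba}=0$; $a\sim b$ if $a\neq b$ and $\theta_{ab}<0$. "Finite Lie type" means $[\theta_{ab}]$ is a Cartan matrix of finite type. A $\Gamma$-colored poset: poset $P$ with surjective $\kappa:P\to\Gamma$. Consecutive elements of color $a$: $x<y$ of color $a$ with no color-$a$ element in $(x,y)$. $U(x,P)=\{y>x:\kappa(y)\sim\kappa(x)\}$, $L(x,P)=\{y<x:\kappa(y)\sim\kappa(x)\}$. $P$ is $\Gamma$-colored minuscule if it is locally finite and: (EC) equal colors are comparable; (NA) elements one covering the other have adjacent colors; (AC) adjacent colors are comparable; (ICE2) for consecutive $x<y$ of color $a$, $\sum_{z\in(x,y)}-\theta_{\kappa(z),a}=2$; (UCB1) for maximal $x\in\kappa^{-1}(a)$, $U(x,P)$ is finite and $\sum_{y\in U(x,P)}-\theta_{\kappa(y),a}\le1$; (LCB1) for minimal $x\in\kappa^{-1}(a)$, $L(x,P)$ finite and $\sum_{y\in L(x,P)}-\theta_{\kappa(y),a}\le1$. Dual isomorphism: order-reversing bijection with order-reversing inverse; dual isomorphic as $\Gamma$-colored posets means additionally colors are preserved up to a diagram automorphism (here the identity). Lie data: simple coroots $\{\alpha_a^\vee\}_{a\in\Gamma}$ form a basis of the coroot lattice; the Weyl group $W$ is generated by simple reflections $s_a$ acting by $s_a(\alpha_b^\vee)=\alpha_b^\vee-\theta_{ab}\alpha_a^\vee$;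 $\Phi^\vee=W\{\alpha_a^\vee\}$, $(\Phi^\vee)^+$ (resp. $(\Phi^\vee)^-$) the coroots with nonnegative (resp. nonpositive) coefficients, ordered by $\beta\le\gamma$ iff $\gamma-\beta$ is a nonnegative integer combination of simple coroots. $\Phi^\vee(w)=\{\beta\in(\Phi^\vee)^+: w\beta\in(\Phi^\vee)^-\}$. $W^{\langle j\rangle}$ is the set of minimal length representatives of the left cosets $W/W_{\langle j\rangle}$, where $W_{\langle j\rangle}$ is generated by $\{s_a:a\ne j\}$. For a finite filter $F$ of $P$ with linear extension $x_f\to\cdots\to x_1$ (so $x_1$ is maximal), the element determined by $F$ is $s_{\kappa(x_f)}\cdots s_{\kappa(x_1)}$ (independent of the linear extension; it is the $\lambda$-minuscule element whose heap is $F$). *)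

theory Defs
  imports Complex_Main "HOL-Algebra.Bij" "HOL-Algebra.Generated_Groups"
begin

section \<open>Dynkin diagrams\<close>

text \<open>The diagram \<open>\<Gamma>\<close> is the (arbitrary, finite) type \<open>'c\<close>; \<open>\<theta> a b\<close> is \<open>\<theta>\<^sub>a\<^sub>b\<close>.\<close>

definition dynkin_diagram :: "('c::finite \<Rightarrow> 'c \<Rightarrow> int) \<Rightarrow> bool" where
  "dynkin_diagram \<theta> \<longleftrightarrow>
     (\<forall>a. \<theta> a a = 2) \<and> (\<forall>a b. a \<noteq> b \<longrightarrow> \<theta> a b \<le> 0) \<and> (\<forall>a b. \<theta> a b = 0 \<longleftrightarrow> \<theta> b a = 0)"

definition adjacent :: "('c::finite \<Rightarrow> 'c \<Rightarrow> int) \<Rightarrow> 'c \<Rightarrow> 'c \<Rightarrow> bool" where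
  "adjacent \<theta> a b \<longleftrightarrow> a \<noteq> b \<and> \<theta> a b < 0"

definition connected_diagram :: "('c::finite \<Rightarrow> 'c \<Rightarrow> int) \<Rightarrow> bool" where
  "connected_diagram \<theta> \<longleftrightarrow> (\<forall>a b. (adjacent \<theta>)\<^sup>*\<^sup>* a b)"

text \<open>A Cartan matrix is of finite type if it has a positive definite symmetrization.\<close>

definition finite_type :: "('c::finite \<Rightarrow> 'c \<Rightarrow> int) \<Rightarrow> bool" where
  "finite_type \<theta> \<longleftrightarrow>
     (\<exists>d :: 'c \<Rightarrow> real.
        (\<forall>a. 0 < d a) \<and>
        (\<forall>a b. d a * \<theta> a b = d b * \<theta> b a) \<and>
        (\<forall>v :: 'c \<Rightarrow> real. v \<noteq> (\<lambda>_. 0) \<longrightarrow> 0 < (\<Sum>a\<in>UNIV. \<Sum>b\<in>UNIV. v a * (d a * \<theta> a b) * v b)))"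

definition diagram_automorphism :: "('c::finite \<Rightarrow> 'c \<Rightarrow> int) \<Rightarrow> ('c \<Rightarrow> 'c) \<Rightarrow> bool" where
  "diagram_automorphism \<theta> \<sigma> \<longleftrightarrow> bij \<sigma> \<and> (\<forall>a b. \<theta> (\<sigma> a) (\<sigma> b) = \<theta> a b)"


section \<open>Posets\<close>

text \<open>A poset is a carrier \<open>P\<close> with a relation \<open>r\<close> such that \<open>partial_order_on P r\<close>;
  \<open>(x, y) \<in> r\<close> is read \<open>x \<le> y\<close>.\<close>

definition open_interval :: "'p set \<Rightarrow> 'p rel \<Rightarrow> 'p \<Rightarrow> 'p \<Rightarrow> 'p set" where
  "open_interval P r x y = {z \<in> P. (x, z) \<in> r \<and> (z, y) \<in> r \<and> z \<noteq> x \<and> z \<noteq> y}"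

definition closed_interval :: "'p set \<Rightarrow> 'p rel \<Rightarrow> 'p \<Rightarrow> 'p \<Rightarrow> 'p set" where
  "closed_interval P r x y = {z \<in> P. (x, z) \<in> r \<and> (z, y) \<in> r}"

definition locally_finite_poset :: "'p set \<Rightarrow> 'p rel \<Rightarrow> bool" where
  "locally_finite_poset P r \<longleftrightarrow> (\<forall>x\<in>P. \<forall>y\<in>P. finite (closed_interval P r x y))"

definition covered_by :: "'p set \<Rightarrow> 'p rel \<Rightarrow> 'p \<Rightarrow> 'p \<Rightarrow> bool" where
  "covered_by P r x y \<longleftrightarrow>
     x \<in> P \<and> y \<in> P \<and> (x, y) \<in> r \<and> x \<noteq> y \<and> open_interval P r x y = {}"

text \<open>Connectedness of the Hasse diagram.\<close>

definition connected_poset :: "'p set \<Rightarrow> 'p rel \<Rightarrow> bool" where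
  "connected_poset P r \<longleftrightarrow> (\<forall>x\<in>P. \<forall>y\<in>P. equivclp (covered_by P r) x y)"

definition maximal_elements :: "'p set \<Rightarrow> 'p rel \<Rightarrow> 'p set" where
  "maximal_elements P r = {x \<in> P. \<forall>y\<in>P. (x, y) \<in> r \<longrightarrow> y = x}"

definition minimal_elements :: "'p set \<Rightarrow> 'p rel \<Rightarrow> 'p set" where
  "minimal_elements P r = {x \<in> P. \<forall>y\<in>P. (y, x) \<in> r \<longrightarrow> y = x}"

definition filter_generated :: "'p set \<Rightarrow> 'p rel \<Rightarrow> 'p \<Rightarrow> 'p set" where
  "filter_generated P r x = {y \<in> P. (x, y) \<in> r}"

definition ideal_generated :: "'p set \<Rightarrow> 'p rel \<Rightarrow> 'p \<Rightarrow> 'p set" where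
  "ideal_generated P r x = {y \<in> P. (y, x) \<in> r}"

definition order_reversing :: "'p set \<Rightarrow> 'p rel \<Rightarrow> 'q rel \<Rightarrow> ('p \<Rightarrow> 'q) \<Rightarrow> bool" where
  "order_reversing P r s f \<longleftrightarrow> (\<forall>x\<in>P. \<forall>y\<in>P. (x, y) \<in> r \<longrightarrow> (f y, f x) \<in> s)"

definition dual_isomorphism ::
    "'p set \<Rightarrow> 'p rel \<Rightarrow> 'q set \<Rightarrow> 'q rel \<Rightarrow> ('p \<Rightarrow> 'q) \<Rightarrow> bool" where
  "dual_isomorphism P r Q s f \<longleftrightarrow>
     bij_betw f P Q \<and> order_reversing P r s f \<and> order_reversing Q s r (the_inv_into P f)"

definition dual_isomorphic :: "'p set \<Rightarrow> 'p rel \<Rightarrow> 'q set \<Rightarrow> 'q rel \<Rightarrow> bool" where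
  "dual_isomorphic P r Q s \<longleftrightarrow> (\<exists>f. dual_isomorphism P r Q s f)"

text \<open>The list is written from bottom to top: \<open>[x\<^sub>f, \<dots>, x\<^sub>1]\<close> with \<open>x\<^sub>1\<close> maximal.\<close>

definition linear_extension :: "'p set \<Rightarrow> 'p rel \<Rightarrow> 'p list \<Rightarrow> bool" where
  "linear_extension F r xs \<longleftrightarrow>
     distinct xs \<and> set xs = F \<and> sorted_wrt (\<lambda>u v. (v, u) \<notin> r) xs"


section \<open>Colored posets\<close>

definition colored_poset :: "'p set \<Rightarrow> 'p rel \<Rightarrow> ('p \<Rightarrow> 'c::finite) \<Rightarrow> bool" where
  "colored_poset P r \<kappa> \<longleftrightarrow> partial_order_on P r \<and> \<kappa> ` P = UNIV"

definition color_class :: "'p set \<Rightarrow> ('p \<Rightarrow> 'c) \<Rightarrow> 'c \<Rightarrow> 'p set" where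
  "color_class P \<kappa> a = {x \<in> P. \<kappa> x = a}"

definition consecutive :: "'p set \<Rightarrow> 'p rel \<Rightarrow> ('p \<Rightarrow> 'c) \<Rightarrow> 'c \<Rightarrow> 'p \<Rightarrow> 'p \<Rightarrow> bool" where
  "consecutive P r \<kappa> a x y \<longleftrightarrow>
     x \<in> color_class P \<kappa> a \<and> y \<in> color_class P \<kappa> a \<and> (x, y) \<in> r \<and> x \<noteq> y \<and>
     open_interval P r x y \<inter> color_class P \<kappa> a = {}"

definition upper_adjacent ::
    "('c::finite \<Rightarrow> 'c \<Rightarrow> int) \<Rightarrow> 'p set \<Rightarrow> 'p rel \<Rightarrow> ('p \<Rightarrow> 'c) \<Rightarrow> 'p \<Rightarrow> 'p set" where
  "upper_adjacent \<theta> P r \<kappa> x = {y \<in> P. (x, y) \<in> r \<and> y \<noteq> x \<and> adjacent \<theta> (\<kappa> y) (\<kappa> x)}"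

definition lower_adjacent ::
    "('c::finite \<Rightarrow> 'c \<Rightarrow> int) \<Rightarrow> 'p set \<Rightarrow> 'p rel \<Rightarrow> ('p \<Rightarrow> 'c) \<Rightarrow> 'p \<Rightarrow> 'p set" where
  "lower_adjacent \<theta> P r \<kappa> x = {y \<in> P. (y, x) \<in> r \<and> y \<noteq> x \<and> adjacent \<theta> (\<kappa> y) (\<kappa> x)}"

definition EC :: "'p set \<Rightarrow> 'p rel \<Rightarrow> ('p \<Rightarrow> 'c) \<Rightarrow> bool" where
  "EC P r \<kappa> \<longleftrightarrow> (\<forall>x\<in>P. \<forall>y\<in>P. \<kappa> x = \<kappa> y \<longrightarrow> (x, y) \<in> r \<or> (y, x) \<in> r)"

definition NA :: "('c::finite \<Rightarrow> 'c \<Rightarrow> int) \<Rightarrow> 'p set \<Rightarrow> 'p rel \<Rightarrow> ('p \<Rightarrow> 'c) \<Rightarrow> bool" where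
  "NA \<theta> P r \<kappa> \<longleftrightarrow> (\<forall>x y. covered_by P r x y \<longrightarrow> adjacent \<theta> (\<kappa> x) (\<kappa> y))"

definition AC :: "('c::finite \<Rightarrow> 'c \<Rightarrow> int) \<Rightarrow> 'p set \<Rightarrow> 'p rel \<Rightarrow> ('p \<Rightarrow> 'c) \<Rightarrow> bool" where
  "AC \<theta> P r \<kappa> \<longleftrightarrow> (\<forall>x\<in>P. \<forall>y\<in>P. adjacent \<theta> (\<kappa> x) (\<kappa> y) \<longrightarrow> (x, y) \<in> r \<or> (y, x) \<in> r)"

definition ICE2 :: "('c::finite \<Rightarrow> 'c \<Rightarrow> int) \<Rightarrow> 'p set \<Rightarrow> 'p rel \<Rightarrow> ('p \<Rightarrow> 'c) \<Rightarrow> bool" where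
  "ICE2 \<theta> P r \<kappa> \<longleftrightarrow>
     (\<forall>a x y. consecutive P r \<kappa> a x y \<longrightarrow> (\<Sum>z\<in>open_interval P r x y. - \<theta> (\<kappa> z) a) = 2)"

definition UCB1 :: "('c::finite \<Rightarrow> 'c \<Rightarrow> int) \<Rightarrow> 'p set \<Rightarrow> 'p rel \<Rightarrow> ('p \<Rightarrow> 'c) \<Rightarrow> bool" where
  "UCB1 \<theta> P r \<kappa> \<longleftrightarrow>
     (\<forall>a. \<forall>x\<in>maximal_elements (color_class P \<kappa> a) r.
        finite (upper_adjacent \<theta> P r \<kappa> x) \<and>
        (\<Sum>y\<in>upper_adjacent \<theta> P r \<kappa> x. - \<theta> (\<kappa> y) a) \<le> 1)"

definition LCB1 :: "('c::finite \<Rightarrow> 'c \<Rightarrow> int) \<Rightarrow> 'p set \<Rightarrow> 'p rel \<Rightarrow> ('p \<Rightarrow> 'c) \<Rightarrow> bool" where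
  "LCB1 \<theta> P r \<kappa> \<longleftrightarrow>
     (\<forall>a. \<forall>x\<in>minimal_elements (color_class P \<kappa> a) r.
        finite (lower_adjacent \<theta> P r \<kappa> x) \<and>
        (\<Sum>y\<in>lower_adjacent \<theta> P r \<kappa> x. - \<theta> (\<kappa> y) a) \<le> 1)"

definition colored_minuscule ::
    "('c::finite \<Rightarrow> 'c \<Rightarrow> int) \<Rightarrow> 'p set \<Rightarrow> 'p rel \<Rightarrow> ('p \<Rightarrow> 'c) \<Rightarrow> bool" where
  "colored_minuscule \<theta> P r \<kappa> \<longleftrightarrow>
     colored_poset P r \<kappa> \<and> locally_finite_poset P r \<and>
     EC P r \<kappa> \<and> NA \<theta> P r \<kappa> \<and> AC \<theta> P r \<kappa> \<and> ICE2 \<theta> P r \<kappa> \<and> UCB1 \<theta> P r \<kappa> \<and> LCB1 \<theta> P r \<kappa>"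

text \<open>Colors are preserved up to the diagram automorphism \<open>\<sigma>\<close>.\<close>

definition colored_dual_isomorphism ::
    "('c::finite \<Rightarrow> 'c \<Rightarrow> int) \<Rightarrow> ('c \<Rightarrow> 'c) \<Rightarrow> 'p set \<Rightarrow> 'p rel \<Rightarrow> ('p \<Rightarrow> 'c) \<Rightarrow>
     'q set \<Rightarrow> 'q rel \<Rightarrow> ('q \<Rightarrow> 'c) \<Rightarrow> ('p \<Rightarrow> 'q) \<Rightarrow> bool" where
  "colored_dual_isomorphism \<theta> \<sigma> P r \<kappa> Q s \<kappa>' f \<longleftrightarrow>
     diagram_automorphism \<theta> \<sigma> \<and> dual_isomorphism P r Q s f \<and> (\<forall>x\<in>P. \<kappa>' (f x) = \<sigma> (\<kappa> x))"


section \<open>Weyl group and coroots\<close>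

text \<open>An element of the coroot lattice is the family \<open>'c \<Rightarrow> int\<close> of its coefficients in the basis
  of simple coroots. The order on the lattice is then the pointwise order of functions
  (see \<open>coroot_le_iff\<close>).\<close>

definition simple_coroot :: "'c::finite \<Rightarrow> 'c \<Rightarrow> int" where
  "simple_coroot a = (\<lambda>c. if c = a then 1 else 0)"

text \<open>Linear extension of the action on the simple coroots (see \<open>simple_reflection_simple_coroot\<close>).\<close>

definition simple_reflection ::
    "('c::finite \<Rightarrow> 'c \<Rightarrow> int) \<Rightarrow> 'c \<Rightarrow> ('c \<Rightarrow> int) \<Rightarrow> ('c \<Rightarrow> int)" where
  "simple_reflection \<theta> a \<beta> = \<beta>(a := \<beta> a - (\<Sum>b\<in>UNIV. \<beta> b * \<theta> a b))"

lemma simple_reflection_simple_coroot: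
  "simple_reflection \<theta> a (simple_coroot b) =
     (\<lambda>c. simple_coroot b c - \<theta> a b * simple_coroot a c)"
  by (auto simp: simple_reflection_def simple_coroot_def if_distrib[of "\<lambda>x. x * _"] cong: if_cong)

lemma coroot_le_iff:
  fixes \<beta> \<gamma> :: "'c::finite \<Rightarrow> int"
  shows "\<beta> \<le> \<gamma> \<longleftrightarrow>
    (\<exists>n :: 'c \<Rightarrow> nat. \<forall>c. \<gamma> c - \<beta> c = (\<Sum>a\<in>UNIV. int (n a) * simple_coroot a c))"
proof -
  have eq: "(\<Sum>a\<in>UNIV. int (n a) * simple_coroot a c) = int (n c)" for n :: "'c \<Rightarrow> nat" and c
    by (simp add: simple_coroot_def if_distrib cong: if_cong)
  show ?thesis
    unfolding eq le_fun_def
  proof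
    assume "\<forall>c. \<beta> c \<le> \<gamma> c"
    then show "\<exists>n. \<forall>c. \<gamma> c - \<beta> c = int (n c)"
      by (intro exI[of _ "\<lambda>c. nat (\<gamma> c - \<beta> c)"]) simp
  next
    assume "\<exists>n. \<forall>c. \<gamma> c - \<beta> c = int (n c)"
    then show "\<forall>c. \<beta> c \<le> \<gamma> c"
      by (metis diff_ge_0_iff_ge of_nat_0_le_iff)
  qed
qed

abbreviation lattice_perms :: "(('c::finite \<Rightarrow> int) \<Rightarrow> ('c \<Rightarrow> int)) monoid" where
  "lattice_perms \<equiv> BijGroup UNIV"

text \<open>\<open>weyl_subgroup \<theta> J\<close> is the subgroup generated by the \<open>s\<^sub>a\<close> with \<open>a \<in> J\<close>.\<close>

definition weyl_subgroup ::
    "('c::finite \<Rightarrow> 'c \<Rightarrow> int) \<Rightarrow> 'c set \<Rightarrow> (('c \<Rightarrow> int) \<Rightarrow> ('c \<Rightarrow> int)) set" where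
  "weyl_subgroup \<theta> J = generate lattice_perms (simple_reflection \<theta> ` J)"

abbreviation weyl_group :: "('c::finite \<Rightarrow> 'c \<Rightarrow> int) \<Rightarrow> (('c \<Rightarrow> int) \<Rightarrow> ('c \<Rightarrow> int)) set" where
  "weyl_group \<theta> \<equiv> weyl_subgroup \<theta> UNIV"

definition weyl_word ::
    "('c::finite \<Rightarrow> 'c \<Rightarrow> int) \<Rightarrow> 'c list \<Rightarrow> ('c \<Rightarrow> int) \<Rightarrow> ('c \<Rightarrow> int)" where
  "weyl_word \<theta> as = foldr (\<lambda>a w. simple_reflection \<theta> a \<circ> w) as id"

definition weyl_length ::
    "('c::finite \<Rightarrow> 'c \<Rightarrow> int) \<Rightarrow> (('c \<Rightarrow> int) \<Rightarrow> ('c \<Rightarrow> int)) \<Rightarrow> nat" where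
  "weyl_length \<theta> w = (LEAST n. \<exists>as. length as = n \<and> weyl_word \<theta> as = w)"

definition min_coset_reps ::
    "('c::finite \<Rightarrow> 'c \<Rightarrow> int) \<Rightarrow> 'c \<Rightarrow> (('c \<Rightarrow> int) \<Rightarrow> ('c \<Rightarrow> int)) set" where
  "min_coset_reps \<theta> j =
     {w \<in> weyl_group \<theta>.
        \<forall>v \<in> w <#\<^bsub>lattice_perms\<^esub> weyl_subgroup \<theta> (UNIV - {j}). weyl_length \<theta> w \<le> weyl_length \<theta> v}"

definition is_longest_element ::
    "('c::finite \<Rightarrow> 'c \<Rightarrow> int) \<Rightarrow> (('c \<Rightarrow> int) \<Rightarrow> ('c \<Rightarrow> int)) set \<Rightarrow>
     (('c \<Rightarrow> int) \<Rightarrow> ('c \<Rightarrow> int)) \<Rightarrow> bool" where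
  "is_longest_element \<theta> A w \<longleftrightarrow>
     w \<in> A \<and> (\<forall>v\<in>A. v \<noteq> w \<longrightarrow> weyl_length \<theta> v < weyl_length \<theta> w)"

definition coroots :: "('c::finite \<Rightarrow> 'c \<Rightarrow> int) \<Rightarrow> ('c \<Rightarrow> int) set" where
  "coroots \<theta> = {w (simple_coroot a) | w a. w \<in> weyl_group \<theta>}"

definition pos_coroots :: "('c::finite \<Rightarrow> 'c \<Rightarrow> int) \<Rightarrow> ('c \<Rightarrow> int) set" where
  "pos_coroots \<theta> = {\<beta> \<in> coroots \<theta>. \<forall>a. 0 \<le> \<beta> a}"

definition neg_coroots :: "('c::finite \<Rightarrow> 'c \<Rightarrow> int) \<Rightarrow> ('c \<Rightarrow> int) set" where
  "neg_coroots \<theta> = {\<beta> \<in> coroots \<theta>. \<forall>a. \<beta> a \<le> 0}"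

definition coroot_order :: "('c::finite \<Rightarrow> int) set \<Rightarrow> ('c \<Rightarrow> int) rel" where
  "coroot_order A = {(\<beta>, \<gamma>). \<beta> \<in> A \<and> \<gamma> \<in> A \<and> \<beta> \<le> \<gamma>}"

definition is_highest_coroot :: "('c::finite \<Rightarrow> 'c \<Rightarrow> int) \<Rightarrow> ('c \<Rightarrow> int) \<Rightarrow> bool" where
  "is_highest_coroot \<theta> \<beta> \<longleftrightarrow> \<beta> \<in> coroots \<theta> \<and> (\<forall>\<gamma>\<in>coroots \<theta>. \<gamma> \<le> \<beta>)"

definition inversion_coroots ::
    "('c::finite \<Rightarrow> 'c \<Rightarrow> int) \<Rightarrow> (('c \<Rightarrow> int) \<Rightarrow> ('c \<Rightarrow> int)) \<Rightarrow> ('c \<Rightarrow> int) set" where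
  "inversion_coroots \<theta> w = {\<beta> \<in> pos_coroots \<theta>. w \<beta> \<in> neg_coroots \<theta>}"

definition coroot_filter :: "('c::finite \<Rightarrow> 'c \<Rightarrow> int) \<Rightarrow> 'c \<Rightarrow> ('c \<Rightarrow> int) set" where
  "coroot_filter \<theta> j =
     filter_generated (pos_coroots \<theta>) (coroot_order (pos_coroots \<theta>)) (simple_coroot j)"

text \<open>For a colored poset satisfying (EC) and (AC), reflections of incomparable elements commute,
  so the element does not depend on the linear extension.\<close>

definition filter_element ::
    "('c::finite \<Rightarrow> 'c \<Rightarrow> int) \<Rightarrow> 'p rel \<Rightarrow> ('p \<Rightarrow> 'c) \<Rightarrow> 'p set \<Rightarrow> ('c \<Rightarrow> int) \<Rightarrow> ('c \<Rightarrow> int)" where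
  "filter_element \<theta> r \<kappa> F =
     (THE w. \<exists>xs. linear_extension F r xs \<and> w = weyl_word \<theta> (map \<kappa> xs))"

end

theory Submission
  imports Defs
begin

text \<open>
  Every filter \<open>F\<close> of \<open>P\<close> determines a weight \<open>\<mu>\<^sub>F = \<lambda> - (\<Sum>z\<in>F. \<alpha>\<^bsub>\<kappa> z\<^esub>)\<close>, where \<open>\<lambda>\<close> is dominant
  because of (UCB1). Conditions (ICE2), (UCB1), (LCB1) say that \<open>\<mu>\<^sub>F\<close> pairs with the simple coroot
  of color \<open>a\<close> to \<open>1\<close>, \<open>-1\<close> or \<open>0\<close> according to whether an element of color \<open>a\<close> can be added
  to \<open>F\<close>, removed from it, or neither. So the \<open>\<mu>\<^sub>F\<close> are permuted by the Weyl group, and \<open>\<lambda>\<close> pairs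
  with each coroot to \<open>-1\<close>, \<open>0\<close> or \<open>1\<close>. A positive coroot of full support then shows that \<open>P\<close>
  has only one maximal element, that is, that \<open>\<lambda>\<close> is the fundamental weight of \<open>j\<close>; hence
  \<open>\<Phi>\<^sub>j\<close> consists of the coroots with coefficient \<open>1\<close> at \<open>j\<close>. Put \<open>\<gamma>\<^sub>x = w\<^sub>F\<^sup>-\<^sup>1 \<alpha>\<^bsub>\<kappa> x\<^esub>\<close> for any \<open>F\<close>
  to which \<open>x\<close> can be added. Reading a linear extension one finds that the inversions of \<open>w\<^sub>F\<close> are
  the \<open>\<gamma>\<^sub>x\<close> with \<open>x \<in> F\<close>. They all have coefficient \<open>1\<close> at \<open>j\<close>, so \<open>w\<^sub>F\<close> keeps the other simple
  coroots positive and its inversion set is an order ideal of \<open>\<Phi>\<^sub>j\<close>; it is all of \<open>\<Phi>\<^sub>j\<close> for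
  \<open>F = P\<close> because \<open>\<mu>\<^sub>P\<close> is antidominant.
\<close>

section \<open>Coroots and Weyl group words\<close>

text \<open>A weight is encoded by its values on the simple coroots, that is, by its coordinates in
  the fundamental weights. Thus \<open>simple_coroot a\<close>, read as a weight, is the fundamental
  weight of \<open>a\<close>, and the row \<open>\<theta> a\<close> is the simple root of
  \<open>a\<close>.\<close>

definition pairing :: "('c::finite \<Rightarrow> int) \<Rightarrow> ('c \<Rightarrow> int) \<Rightarrow> int" where
  "pairing \<mu> \<beta> = (\<Sum>c\<in>UNIV. \<mu> c * \<beta> c)"

lemma pairing_simple_coroot [simp]: "pairing \<mu> (simple_coroot a) = \<mu> a"
  by (simp add: pairing_def simple_coroot_def if_distrib cong: if_cong)

lemma simple_coroot_pairing [simp]: "pairing (simple_coroot a) \<beta> = \<beta> a"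
  by (simp add: pairing_def simple_coroot_def if_distrib[of "\<lambda>x. x * _"] cong: if_cong)

lemma pairing_diff_right:
  "pairing \<mu> (\<lambda>c. \<beta> c - k * \<gamma> c) = pairing \<mu> \<beta> - k * pairing \<mu> \<gamma>"
  by (simp add: pairing_def algebra_simps sum_subtractf sum_distrib_left)

lemma pairing_diff_left:
  "pairing (\<lambda>c. \<mu> c - k * \<nu> c) \<beta> = pairing \<mu> \<beta> - k * pairing \<nu> \<beta>"
  by (simp add: pairing_def algebra_simps sum_subtractf sum_distrib_left)

lemma simple_reflection_eq:
  "simple_reflection \<theta> a \<beta> = (\<lambda>c. \<beta> c - pairing (\<theta> a) \<beta> * simple_coroot a c)"
  by (auto simp: simple_reflection_def simple_coroot_def pairing_def mult.commute)

lemma simple_reflection_other [simp]: "c \<noteq> a \<Longrightarrow> simple_reflection \<theta> a \<beta> c = \<beta> c"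
  by (simp add: simple_reflection_def)

lemma simple_reflection_linear:
  "simple_reflection \<theta> a (\<lambda>c. k * \<beta> c + l * \<gamma> c) =
    (\<lambda>c. k * simple_reflection \<theta> a \<beta> c + l * simple_reflection \<theta> a \<gamma> c)"
  by (auto simp: simple_reflection_eq pairing_def algebra_simps sum.distrib sum_distrib_left
      sum_distrib_right)

lemma weyl_word_Nil [simp]: "weyl_word \<theta> [] = id"
  by (simp add: weyl_word_def)

lemma weyl_word_Cons [simp]: "weyl_word \<theta> (a # as) = simple_reflection \<theta> a \<circ> weyl_word \<theta> as"
  by (simp add: weyl_word_def)

lemma weyl_word_append [simp]: "weyl_word \<theta> (as @ bs) = weyl_word \<theta> as \<circ> weyl_word \<theta> bs"
  by (induction as) (auto simp: o_assoc)

lemma weyl_word_linear: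
  "weyl_word \<theta> as (\<lambda>c. k * \<beta> c + l * \<gamma> c) =
    (\<lambda>c. k * weyl_word \<theta> as \<beta> c + l * weyl_word \<theta> as \<gamma> c)"
  by (induction as) (simp_all add: simple_reflection_linear)

lemma weyl_word_uminus: "weyl_word \<theta> as (\<lambda>c. - \<beta> c) = (\<lambda>c. - weyl_word \<theta> as \<beta> c)"
  using weyl_word_linear[of \<theta> as "-1" \<beta> 0 \<beta>] by simp

lemma weyl_word_diff:
  "weyl_word \<theta> as (\<lambda>c. \<beta> c - k * \<gamma> c) = (\<lambda>c. weyl_word \<theta> as \<beta> c - k * weyl_word \<theta> as \<gamma> c)"
  using weyl_word_linear[of \<theta> as 1 \<beta> "-k" \<gamma>] by simp

lemma weyl_word_sum:
  assumes "finite I"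
  shows "weyl_word \<theta> as (\<lambda>c. \<Sum>i\<in>I. k i * f i c) = (\<lambda>c. \<Sum>i\<in>I. k i * weyl_word \<theta> as (f i) c)"
  using assms
proof (induction I)
  case empty
  show ?case
    using weyl_word_linear[of \<theta> as 0 "\<lambda>_. 0" 0 "\<lambda>_. 0"] by simp
next
  case (insert i I)
  then show ?case
    using weyl_word_linear[of \<theta> as "k i" "f i" 1 "\<lambda>c. \<Sum>i\<in>I. k i * f i c"] by simp
qed

lemma weyl_word_expand:
  "weyl_word \<theta> as \<beta> = (\<lambda>c. \<Sum>b\<in>UNIV. \<beta> b * weyl_word \<theta> as (simple_coroot b) c)"
proof -
  have "\<beta> = (\<lambda>c. \<Sum>b\<in>UNIV. \<beta> b * simple_coroot b c)"
    by (simp add: simple_coroot_def if_distrib cong: if_cong)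
  then show ?thesis
    using weyl_word_sum[of UNIV \<theta> as \<beta> simple_coroot] by simp
qed

section \<open>Words in the simple reflections and the coroots they produce\<close>

locale finite_cartan =
  fixes \<theta> :: "'c::finite \<Rightarrow> 'c \<Rightarrow> int" and d :: "'c \<Rightarrow> real"
  assumes diag [simp]: "\<theta> a a = 2"
    and offdiag: "a \<noteq> b \<Longrightarrow> \<theta> a b \<le> 0"
    and zero_sym: "\<theta> a b = 0 \<longleftrightarrow> \<theta> b a = 0"
    and d_pos: "0 < d a"
    and d_sym: "d a * \<theta> a b = d b * \<theta> b a"
    and pos_def: "v \<noteq> (\<lambda>_. 0) \<Longrightarrow> 0 < (\<Sum>a\<in>UNIV. \<Sum>b\<in>UNIV. v a * (d a * \<theta> a b) * v b)"
begin

abbreviation refl :: "'c \<Rightarrow> ('c \<Rightarrow> int) \<Rightarrow> 'c \<Rightarrow> int" where "refl \<equiv> simple_reflection \<theta>"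
abbreviation word :: "'c list \<Rightarrow> ('c \<Rightarrow> int) \<Rightarrow> 'c \<Rightarrow> int" where "word \<equiv> weyl_word \<theta>"
abbreviation \<alpha> :: "'c \<Rightarrow> 'c \<Rightarrow> int" where "\<alpha> \<equiv> simple_coroot"
abbreviation \<Phi> :: "('c \<Rightarrow> int) set" where "\<Phi> \<equiv> coroots \<theta>"
abbreviation pos :: "('c \<Rightarrow> int) set" where "pos \<equiv> pos_coroots \<theta>"
abbreviation neg :: "('c \<Rightarrow> int) set" where "neg \<equiv> neg_coroots \<theta>"
abbreviation Inv :: "(('c \<Rightarrow> int) \<Rightarrow> 'c \<Rightarrow> int) \<Rightarrow> ('c \<Rightarrow> int) set"
  where "Inv \<equiv> inversion_coroots \<theta>"

lemma refl_simple: "refl a (\<alpha> a) = (\<lambda>c. - \<alpha> a c)"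
  by (simp add: simple_reflection_eq)

lemma refl_refl [simp]: "refl a (refl a \<beta>) = \<beta>"
  by (auto simp: simple_reflection_eq pairing_diff_right)

lemma word_rev_word [simp]: "word (rev as) (word as \<beta>) = \<beta>"
  by (induction as arbitrary: \<beta>) auto

lemma word_word_rev [simp]: "word as (word (rev as) \<beta>) = \<beta>"
  using word_rev_word[of "rev as"] by simp

lemma bij_word: "bij (word as)"
  by (rule o_bij[of "word (rev as)"]) (auto simp: fun_eq_iff)

lemma word_rev_cong:
  assumes "word as = word bs"
  shows "word (rev as) = word (rev bs)"
  by (metis assms word_rev_word word_word_rev ext)

lemma weyl_subgroup_eq: "weyl_subgroup \<theta> J = word ` {as. set as \<subseteq> J}"
proof
  have refl_Bij: "refl a \<in> Bij UNIV" for a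
    using bij_word[of "[a]"] by (simp add: Bij_def)
  have inv_eq: "inv\<^bsub>lattice_perms\<^esub> (refl a) = refl a" for a
  proof -
    have "inv_into UNIV (refl a) = refl a"
      by (rule inv_unique_comp) (auto simp: fun_eq_iff)
    then show ?thesis
      using inv_BijGroup[OF refl_Bij, of a] by (simp add: restrict_def)
  qed
  have mult: "f \<otimes>\<^bsub>lattice_perms\<^esub> g = f \<circ> g"
    if "f \<in> Bij UNIV" "g \<in> Bij UNIV" for f g :: "('c \<Rightarrow> int) \<Rightarrow> 'c \<Rightarrow> int"
    using that by (auto simp: BijGroup_def compose_def)
  have word_Bij: "word as \<in> Bij UNIV" for as
    using bij_word by (auto simp: Bij_def)
  show "weyl_subgroup \<theta> J \<subseteq> word ` {as. set as \<subseteq> J}"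
  proof
    fix w assume "w \<in> weyl_subgroup \<theta> J"
    then have "w \<in> generate lattice_perms (refl ` J)"
      by (simp add: weyl_subgroup_def)
    then show "w \<in> word ` {as. set as \<subseteq> J}"
    proof induction
      case one
      have "\<one>\<^bsub>lattice_perms\<^esub> = word []"
        by (auto simp: BijGroup_def)
      then show ?case by (intro image_eqI[of _ _ "[]"]) auto
    next
      case (incl h)
      then obtain a where "a \<in> J" "h = word [a]" by auto
      then show ?case by (intro image_eqI[of _ _ "[a]"]) auto
    next
      case (inv h)
      then obtain a where "a \<in> J" "h = refl a" by auto
      then show ?case by (intro image_eqI[of _ _ "[a]"]) (auto simp: inv_eq)
    next
      case (eng h1 h2)
      then obtain as bs where "set as \<subseteq> J" "set bs \<subseteq> J" "h1 = word as" "h2 = word bs" by auto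
      then show ?case
        by (intro image_eqI[of _ _ "as @ bs"]) (auto simp: mult word_Bij)
    qed
  qed
  show "word ` {as. set as \<subseteq> J} \<subseteq> weyl_subgroup \<theta> J"
  proof safe
    fix as assume "set as \<subseteq> J"
    then show "word as \<in> weyl_subgroup \<theta> J"
    proof (induction as)
      case Nil
      have "\<one>\<^bsub>lattice_perms\<^esub> = word []"
        by (auto simp: BijGroup_def)
      then show ?case
        using generate.one[of lattice_perms "refl ` J"] by (metis weyl_subgroup_def)
    next
      case (Cons a as)
      then have "word as \<in> generate lattice_perms (refl ` J)" by (simp add: weyl_subgroup_def)
      moreover have "refl a \<in> generate lattice_perms (refl ` J)"
        using Cons.prems by (intro generate.incl) auto
      ultimately have "refl a \<otimes>\<^bsub>lattice_perms\<^esub> word as \<in> generate lattice_perms (refl ` J)"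
        by (intro generate.eng)
      then show ?case
        by (metis mult refl_Bij word_Bij weyl_subgroup_def weyl_word_Cons)
    qed
  qed
qed

lemma weyl_group_eq: "weyl_group \<theta> = range word"
  by (simp add: weyl_subgroup_eq)

lemma coroots_eq: "\<Phi> = {word as (\<alpha> a) | as a. True}"
  unfolding coroots_def weyl_group_eq by blast

lemma simple_in_coroots [simp]: "\<alpha> a \<in> \<Phi>"
  unfolding coroots_eq by (metis (mono_tags, lifting) id_apply mem_Collect_eq weyl_word_Nil)

lemma word_in_coroots [simp]: "\<beta> \<in> \<Phi> \<Longrightarrow> word as \<beta> \<in> \<Phi>"
  unfolding coroots_eq mem_Collect_eq by (metis comp_apply weyl_word_append)

lemma refl_in_coroots [simp]: "\<beta> \<in> \<Phi> \<Longrightarrow> refl a \<beta> \<in> \<Phi>"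
  using word_in_coroots[of \<beta> "[a]"] by simp

lemma uminus_in_coroots: "\<beta> \<in> \<Phi> \<Longrightarrow> (\<lambda>c. - \<beta> c) \<in> \<Phi>"
proof -
  assume "\<beta> \<in> \<Phi>"
  then obtain as a where "\<beta> = word as (\<alpha> a)" unfolding coroots_eq by blast
  then have "(\<lambda>c. - \<beta> c) = word (as @ [a]) (\<alpha> a)"
    by (simp add: refl_simple weyl_word_uminus)
  then show ?thesis by simp
qed

lemma word_zero [simp]: "word as (\<lambda>_. 0) = (\<lambda>_. 0)"
  using weyl_word_linear[of \<theta> as 0 "\<lambda>_. 0" 0 "\<lambda>_. 0"] by simp

lemma coroot_nonzero: "\<beta> \<in> \<Phi> \<Longrightarrow> \<beta> \<noteq> (\<lambda>_. 0)"
proof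
  assume "\<beta> \<in> \<Phi>" and zero: "\<beta> = (\<lambda>_. 0)"
  then obtain as a where "\<beta> = word as (\<alpha> a)" unfolding coroots_eq by blast
  then have *: "(\<lambda>_. 0) = word as (\<alpha> a)" using zero by simp
  then have "\<alpha> a = word (rev as) (\<lambda>_. 0)" by simp
  then have "\<alpha> a a = 0" by simp
  then show False by (simp add: simple_coroot_def)
qed

section \<open>The Weyl-invariant inner product and the signs of coroots\<close>

definition form :: "('c \<Rightarrow> int) \<Rightarrow> ('c \<Rightarrow> int) \<Rightarrow> real" where
  "form \<beta> \<gamma> = (\<Sum>a\<in>UNIV. \<Sum>b\<in>UNIV. \<beta> a * (d a * \<theta> a b) * \<gamma> b)"

lemma form_pos: "\<beta> \<noteq> (\<lambda>_. 0) \<Longrightarrow> 0 < form \<beta> \<beta>"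
  using pos_def[of "\<lambda>a. of_int (\<beta> a)"] by (auto simp: form_def fun_eq_iff)

lemma form_sym: "form \<beta> \<gamma> = form \<gamma> \<beta>"
  unfolding form_def
  by (subst sum.swap) (simp add: d_sym mult.commute mult.left_commute)

lemma form_diff_left: "form (\<lambda>c. \<beta> c - k * \<beta>' c) \<gamma> = form \<beta> \<gamma> - k * form \<beta>' \<gamma>"
  by (simp add: form_def algebra_simps sum_subtractf sum_distrib_left)

lemma form_diff_right: "form \<gamma> (\<lambda>c. \<beta> c - k * \<beta>' c) = form \<gamma> \<beta> - k * form \<gamma> \<beta>'"
  by (simp add: form_sym[of \<gamma>] form_diff_left)

lemma form_simple_left: "form (\<alpha> a) \<gamma> = d a * pairing (\<theta> a) \<gamma>"
proof -
  have "form (\<alpha> a) \<gamma> = (\<Sum>x\<in>UNIV. if x = a then \<Sum>b\<in>UNIV. d a * \<theta> a b * \<gamma> b else 0)"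
    unfolding form_def by (rule sum.cong) (auto simp: simple_coroot_def)
  then show ?thesis
    by (simp add: pairing_def sum_distrib_left algebra_simps)
qed

lemma form_refl: "form (refl a \<beta>) (refl a \<gamma>) = form \<beta> \<gamma>"
  unfolding simple_reflection_eq form_diff_left form_diff_right form_sym[of \<beta> "\<alpha> a"]
    form_simple_left by (simp add: algebra_simps)

lemma form_word: "form (word as \<beta>) (word as \<gamma>) = form \<beta> \<gamma>"
  by (induction as) (auto simp: form_refl)

text \<open>Off-diagonal terms come in equal pairs. This parity is the source of the factor 2 in
  \<open>form_ge\<close>.\<close>

lemma even_symmetric_sum:
  fixes g :: "'a \<Rightarrow> 'a \<Rightarrow> int"
  assumes "finite A" "\<And>a b. g a b = g b a" "\<And>a. even (g a a)"
  shows "even (\<Sum>a\<in>A. \<Sum>b\<in>A. g a b)"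
  using assms(1)
proof induction
  case (insert x A)
  have "(\<Sum>a\<in>insert x A. \<Sum>b\<in>insert x A. g a b) =
      g x x + 2 * (\<Sum>b\<in>A. g x b) + (\<Sum>a\<in>A. \<Sum>b\<in>A. g a b)"
    using insert assms(2) by (simp add: sum.distrib)
  then show ?case using insert assms(3) by simp
qed simp

text \<open>Dividing the norm of \<open>v\<close> by \<open>e\<close> leaves a double sum of
  integers that is symmetric with even diagonal, hence an even integer; positive definiteness makes
  it at least 2. With \<open>e = d b\<close> the bound is the norm of
  \<open>\<alpha> b\<close>.\<close>

lemma form_ge:
  assumes "v \<noteq> (\<lambda>_. 0)" "0 < e" "\<And>c. d c * of_int (v c) = e * of_int (m c)"
  shows "2 * e \<le> form v v"
proof -
  define g where "g a b = m a * \<theta> a b * v b" for a b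
  have g: "e * of_int (g a b) = of_int (v a) * (d a * of_int (\<theta> a b)) * of_int (v b)" for a b
    using assms(3)[of a] by (simp add: g_def mult.assoc mult.left_commute)
  have "e * of_int (g a b) = e * of_int (g b a)" for a b
    unfolding g by (simp add: d_sym[of a b] mult.commute mult.left_commute)
  then have sym: "g a b = g b a" for a b
    using assms(2) by (metis less_irrefl mult_left_cancel of_int_eq_iff)
  have "even (\<Sum>a\<in>UNIV. \<Sum>b\<in>UNIV. g a b)"
    by (rule even_symmetric_sum[OF finite_class.finite_UNIV sym]) (simp add: g_def)
  then obtain k where k: "(\<Sum>a\<in>UNIV. \<Sum>b\<in>UNIV. g a b) = 2 * k" by (rule evenE)
  have "form v v = e * of_int (\<Sum>a\<in>UNIV. \<Sum>b\<in>UNIV. g a b)"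
    unfolding form_def by (simp add: sum_distrib_left g)
  then have f: "form v v = 2 * e * of_int k" by (simp add: k)
  then have "0 < k" using form_pos[OF assms(1)] assms(2) by (simp add: zero_less_mult_iff)
  then have "1 \<le> real_of_int k" by simp
  then show ?thesis using f assms(2) by simp
qed

text \<open>The divisibility that \<open>form_ge\<close> asks for. It survives \<open>refl a\<close>
  because symmetry of the form rewrites \<open>d a\<close> times the change of the coefficient at
  \<open>a\<close> as a combination of the numbers \<open>d c * \<beta> c\<close>.\<close>

lemma coroot_integrality:
  "\<exists>m. \<forall>c. d c * of_int (word as (\<alpha> b) c) = d b * of_int (m c :: int)"
proof (induction as)
  case Nil
  show ?case by (intro exI[of _ "\<alpha> b"]) (auto simp: simple_coroot_def)
next
  case (Cons a as)
  define \<beta> where "\<beta> = word as (\<alpha> b)"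
  obtain m where m: "\<And>c. d c * of_int (\<beta> c) = d b * of_int (m c :: int)"
    using Cons \<beta>_def by blast
  \<comment> \<open>The coefficients \<open>m\<close> transform by the reflection of the transposed
    Cartan matrix.\<close>
  define n where "n = m(a := m a - (\<Sum>c\<in>UNIV. m c * \<theta> c a))"
  have "d a * (\<Sum>c\<in>UNIV. of_int (\<theta> a c) * of_int (\<beta> c)) =
      (\<Sum>c\<in>UNIV. d a * of_int (\<theta> a c) * of_int (\<beta> c))"
    by (simp add: sum_distrib_left mult.assoc)
  also have "\<dots> = (\<Sum>c\<in>UNIV. d c * of_int (\<beta> c) * of_int (\<theta> c a))"
    by (rule sum.cong) (auto simp: d_sym[of a] mult.assoc mult.left_commute mult.commute)
  also have "\<dots> = d b * (\<Sum>c\<in>UNIV. of_int (m c) * of_int (\<theta> c a))"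
    by (simp add: m sum_distrib_left mult.assoc)
  finally have "d a * of_int (pairing (\<theta> a) \<beta>) = d b * of_int (\<Sum>c\<in>UNIV. m c * \<theta> c a)"
    by (simp add: pairing_def)
  then have "d c * of_int (refl a \<beta> c) = d b * of_int (n c)" for c
    using m by (auto simp: simple_reflection_eq n_def simple_coroot_def right_diff_distrib)
  then show ?case by (auto simp: \<beta>_def)
qed

text \<open>If \<open>\<beta> = w \<alpha>\<^sub>b\<close> had coefficients of both signs, its positive and its negative part would
  both inherit the divisibility of \<open>d\<^sub>c \<beta>\<^sub>c\<close> by \<open>d\<^sub>b\<close>, hence both have norm at least \<open>2 d\<^sub>b\<close>,
  which is the norm of \<open>\<beta>\<close>. As the two parts have nonpositive product, this is absurd.\<close>

lemma coroot_dichotomy: "\<beta> \<in> \<Phi> \<Longrightarrow> \<beta> \<in> pos \<or> \<beta> \<in> neg"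
proof (rule ccontr)
  assume \<beta>: "\<beta> \<in> \<Phi>" and "\<not> (\<beta> \<in> pos \<or> \<beta> \<in> neg)"
  then obtain a1 a2 where a: "\<beta> a1 < 0" "0 < \<beta> a2"
    by (auto simp: pos_coroots_def neg_coroots_def not_le)
  obtain as b where \<beta>_eq: "\<beta> = word as (\<alpha> b)" using \<beta> unfolding coroots_eq by blast
  obtain m where m: "\<And>c. d c * of_int (\<beta> c) = d b * of_int (m c :: int)"
    using coroot_integrality \<beta>_eq by metis
  define p where "p c = max (\<beta> c) 0" for c
  define n where "n c = max (- \<beta> c) 0" for c
  have \<beta>_pn: "\<beta> = (\<lambda>c. p c - 1 * n c)" by (auto simp: p_def n_def)
  have "2 * d b \<le> form p p"
    by (rule form_ge[of _ _ "\<lambda>c. if 0 < \<beta> c then m c else 0"])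
      (use a m d_pos in \<open>auto simp: p_def fun_eq_iff max_def intro: exI[of _ a2]\<close>)
  moreover have "2 * d b \<le> form n n"
    by (rule form_ge[of _ _ "\<lambda>c. if \<beta> c < 0 then - m c else 0"])
      (use a m d_pos in \<open>auto simp: n_def fun_eq_iff max_def intro: exI[of _ a1]\<close>)
  moreover have "form p n \<le> 0"
    unfolding form_def
  proof (intro sum_nonpos)
    fix a c
    show "real_of_int (p a) * (d a * real_of_int (\<theta> a c)) * real_of_int (n c) \<le> 0"
    proof (cases "a = c")
      case False
      then have "d a * real_of_int (\<theta> a c) \<le> 0"
        using offdiag d_pos by (simp add: mult_nonneg_nonpos less_imp_le)
      then have "real_of_int (p a) * (d a * real_of_int (\<theta> a c)) \<le> 0"
        by (simp add: mult_nonneg_nonpos p_def)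
      then show ?thesis by (simp add: mult_nonpos_nonneg n_def)
    qed (auto simp: p_def n_def)
  qed
  moreover have "form \<beta> \<beta> = form p p - 2 * form p n + form n n"
    unfolding \<beta>_pn form_diff_left form_diff_right using form_sym[of n p] by simp
  moreover have "form \<beta> \<beta> = 2 * d b"
    unfolding \<beta>_eq form_word by (simp add: form_simple_left)
  ultimately show False using d_pos[of b] by linarith
qed

section \<open>Positive and negative coroots under a simple reflection\<close>

lemma pos_in_coroots: "\<beta> \<in> pos \<Longrightarrow> \<beta> \<in> \<Phi>"
  by (simp add: pos_coroots_def)

lemma simple_pos [simp]: "\<alpha> a \<in> pos"
  by (auto simp: pos_coroots_def) (simp add: simple_coroot_def)

lemma pos_not_neg: "\<beta> \<in> pos \<Longrightarrow> \<beta> \<notin> neg"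
proof
  assume "\<beta> \<in> pos" "\<beta> \<in> neg"
  then have "\<beta> = (\<lambda>_. 0)" by (auto simp: pos_coroots_def neg_coroots_def fun_eq_iff intro: antisym)
  then show False using coroot_nonzero \<open>\<beta> \<in> pos\<close> pos_in_coroots by blast
qed

lemma coroot_pos_if: "\<beta> \<in> \<Phi> \<Longrightarrow> 0 < \<beta> c \<Longrightarrow> \<beta> \<in> pos"
  using coroot_dichotomy[of \<beta>] by (auto simp: neg_coroots_def not_less[symmetric])

lemma uminus_pos_iff: "(\<lambda>c. - \<beta> c) \<in> pos \<longleftrightarrow> \<beta> \<in> neg"
  using uminus_in_coroots[of \<beta>] uminus_in_coroots[of "\<lambda>c. - \<beta> c"]
  by (auto simp: pos_coroots_def neg_coroots_def)

lemma uminus_neg_iff: "(\<lambda>c. - \<beta> c) \<in> neg \<longleftrightarrow> \<beta> \<in> pos"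
  using uminus_pos_iff[of "\<lambda>c. - \<beta> c"] by simp

text \<open>Weyl group elements have integer matrices: undoing the word writes
  \<open>\<alpha> b\<close>, which has a coefficient 1, as \<open>\<beta> a\<close> times an integer
  vector.\<close>

lemma coroot_not_multiple:
  assumes "\<beta> \<in> \<Phi>" "\<And>c. c \<noteq> a \<Longrightarrow> \<beta> c = 0"
  shows "\<bar>\<beta> a\<bar> = 1"
proof -
  obtain as b where b: "\<beta> = word as (\<alpha> b)" using assms(1) unfolding coroots_eq by blast
  have "\<beta> = (\<lambda>c. \<beta> a * \<alpha> a c + 0 * \<alpha> a c)"
    using assms(2) by (auto simp: simple_coroot_def)
  then have "word (rev as) \<beta> = (\<lambda>c. \<beta> a * word (rev as) (\<alpha> a) c + 0 * word (rev as) (\<alpha> a) c)"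
    using weyl_word_linear by metis
  then have "\<alpha> b = (\<lambda>c. \<beta> a * word (rev as) (\<alpha> a) c)" by (simp only: b word_rev_word) simp
  then have "\<alpha> b b = \<beta> a * word (rev as) (\<alpha> a) b" by (rule fun_cong)
  then have "\<bar>\<beta> a * word (rev as) (\<alpha> a) b\<bar> = 1" by (simp add: simple_coroot_def)
  then show ?thesis by (rule abs_zmult_eq_1)
qed

text \<open>The reflection alters only the coefficient at \<open>a\<close>. A positive coefficient
  elsewhere survives, and by the dichotomy it decides the sign of the image.\<close>

lemma refl_pos: "\<beta> \<in> pos \<Longrightarrow> \<beta> \<noteq> \<alpha> a \<Longrightarrow> refl a \<beta> \<in> pos"
proof -
  assume \<beta>: "\<beta> \<in> pos" "\<beta> \<noteq> \<alpha> a"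
  have "\<exists>c. c \<noteq> a \<and> \<beta> c \<noteq> 0"
  proof (rule ccontr)
    assume "\<nexists>c. c \<noteq> a \<and> \<beta> c \<noteq> 0"
    then have *: "\<And>c. c \<noteq> a \<Longrightarrow> \<beta> c = 0" by blast
    then have "\<bar>\<beta> a\<bar> = 1" using coroot_not_multiple \<beta>(1) pos_in_coroots by blast
    then have "\<beta> a = 1" using \<beta>(1) by (simp add: pos_coroots_def)
    then have "\<beta> = \<alpha> a" using * by (auto simp: simple_coroot_def)
    then show False using \<beta>(2) by simp
  qed
  then obtain c where "c \<noteq> a" "0 < \<beta> c" using \<beta>(1) by (auto simp: pos_coroots_def less_le)
  then show ?thesis
    using coroot_pos_if[of "refl a \<beta>" c] \<beta>(1) pos_in_coroots by simp
qed

lemma refl_neg: "\<beta> \<in> neg \<Longrightarrow> \<beta> \<noteq> (\<lambda>c. - \<alpha> a c) \<Longrightarrow> refl a \<beta> \<in> neg"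
proof -
  assume "\<beta> \<in> neg" "\<beta> \<noteq> (\<lambda>c. - \<alpha> a c)"
  then have "refl a (\<lambda>c. - \<beta> c) \<in> pos"
    by (intro refl_pos) (auto simp: uminus_pos_iff fun_eq_iff, metis minus_minus)
  moreover have "refl a (\<lambda>c. - \<beta> c) = (\<lambda>c. - refl a \<beta> c)"
    using weyl_word_uminus[of \<theta> "[a]"] by simp
  ultimately show ?thesis by (simp add: uminus_pos_iff)
qed

section \<open>Inversion sets and the exchange condition\<close>

lemma inversions_Cons_subset:
  "Inv (word (a # as)) \<subseteq> insert (word (rev as) (\<alpha> a)) (Inv (word as))"
proof
  fix \<beta> assume "\<beta> \<in> Inv (word (a # as))"
  then have \<beta>: "\<beta> \<in> pos" "refl a (word as \<beta>) \<in> neg" by (auto simp: inversion_coroots_def)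
  show "\<beta> \<in> insert (word (rev as) (\<alpha> a)) (Inv (word as))"
  proof (cases "word as \<beta> \<in> pos")
    case True
    then have "word as \<beta> = \<alpha> a" using \<beta>(2) refl_pos pos_not_neg by blast
    then show ?thesis by (metis word_rev_word insertI1)
  next
    case False
    then show ?thesis
      using \<beta> coroot_dichotomy[of "word as \<beta>"] pos_in_coroots
      by (auto simp: inversion_coroots_def)
  qed
qed

lemma finite_inversions: "finite (Inv (word as))"
proof (induction as)
  case Nil
  have "Inv (word []) = {}" using pos_not_neg by (auto simp: inversion_coroots_def)
  then show ?case by (metis finite.emptyI)
next
  case (Cons a as)
  then show ?case using inversions_Cons_subset finite_subset by blast
qed

text \<open>Only \<open>\<alpha> a\<close> and its negative change sign under \<open>refl a\<close>.
  If the preimage of \<open>\<alpha> a\<close> is positive, it becomes an inversion, and no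
  inversion of \<open>word as\<close> is lost.\<close>

lemma inversions_Cons:
  assumes "word (rev as) (\<alpha> a) \<in> pos"
  shows "Inv (word (a # as)) = insert (word (rev as) (\<alpha> a)) (Inv (word as))"
    and "word (rev as) (\<alpha> a) \<notin> Inv (word as)"
proof
  show new: "word (rev as) (\<alpha> a) \<notin> Inv (word as)"
    using pos_not_neg by (auto simp: inversion_coroots_def)
  have "(\<lambda>c. - \<alpha> a c) \<in> neg" by (simp add: uminus_neg_iff)
  then have "word (rev as) (\<alpha> a) \<in> Inv (word (a # as))"
    using assms by (simp add: inversion_coroots_def refl_simple)
  moreover have "Inv (word as) \<subseteq> Inv (word (a # as))"
  proof
    fix \<beta> assume \<beta>: "\<beta> \<in> Inv (word as)"
    have "word as \<beta> \<noteq> (\<lambda>c. - \<alpha> a c)"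
    proof
      assume "word as \<beta> = (\<lambda>c. - \<alpha> a c)"
      then have "word (rev as) (word as \<beta>) = (\<lambda>c. - word (rev as) (\<alpha> a) c)"
        by (simp only: weyl_word_uminus)
      then have "\<beta> \<in> neg" using assms by (simp add: uminus_neg_iff)
      then show False using \<beta> pos_not_neg by (auto simp: inversion_coroots_def)
    qed
    then show "\<beta> \<in> Inv (word (a # as))"
      using \<beta> refl_neg by (auto simp: inversion_coroots_def)
  qed
  ultimately show "insert (word (rev as) (\<alpha> a)) (Inv (word as)) \<subseteq> Inv (word (a # as))" by blast
  show "Inv (word (a # as)) \<subseteq> insert (word (rev as) (\<alpha> a)) (Inv (word as))"
    by (rule inversions_Cons_subset)
qed

text \<open>A reflection is determined by its coroot and the form: words are isometries, so
  \<open>d a = d b\<close>, and the pairings with the two simple roots correspond.\<close>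

lemma refl_conjugate:
  assumes "word as (\<alpha> b) = \<alpha> a"
  shows "refl a \<circ> word as = word as \<circ> refl b"
proof
  fix \<gamma>
  have "form (\<alpha> a) (\<alpha> a) = form (\<alpha> b) (\<alpha> b)" using assms form_word[of as "\<alpha> b" "\<alpha> b"] by simp
  then have "d a = d b" by (simp add: form_simple_left)
  moreover have "form (\<alpha> a) (word as \<gamma>) = form (\<alpha> b) \<gamma>" using assms form_word[of as "\<alpha> b"] by metis
  ultimately have "pairing (\<theta> a) (word as \<gamma>) = pairing (\<theta> b) \<gamma>"
    using d_pos[of b] by (simp add: form_simple_left)
  then show "(refl a \<circ> word as) \<gamma> = (word as \<circ> refl b) \<gamma>"
    using assms by (simp add: simple_reflection_eq weyl_word_diff)
qed

text \<open>Following \<open>\<alpha> a\<close> through the letters of \<open>bs\<close>, there is a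
  letter \<open>b\<close> at which it turns negative. Just before, it equals
  \<open>\<alpha> b\<close>, so conjugation carries the reflection at \<open>a\<close> to that
  letter, where the two cancel.\<close>

lemma exchange:
  assumes "word (rev bs) (\<alpha> a) \<in> neg"
  shows "\<exists>cs. length cs < length bs \<and> word (a # bs) = word cs"
  using assms
proof (induction bs rule: rev_induct)
  case Nil
  then show ?case using pos_not_neg simple_pos by auto
next
  case (snoc b bs)
  let ?\<beta> = "word (rev bs) (\<alpha> a)"
  show ?case
  proof (cases "?\<beta> \<in> neg")
    case True
    then obtain cs where "length cs < length bs" "word (a # bs) = word cs" using snoc by blast
    then show ?thesis by (intro exI[of _ "cs @ [b]"]) (auto simp: o_assoc)
  next
    case False
    then have "?\<beta> \<in> pos" using coroot_dichotomy[of ?\<beta>] by auto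
    moreover have "refl b ?\<beta> \<in> neg" using snoc by simp
    ultimately have "?\<beta> = \<alpha> b" using refl_pos pos_not_neg by blast
    then have "word bs (\<alpha> b) = \<alpha> a" by (metis word_word_rev)
    then have "refl a \<circ> word bs = word bs \<circ> refl b" by (rule refl_conjugate)
    then have "word (a # bs @ [b]) = word bs" by (auto simp: fun_eq_iff)
    then show ?thesis by (intro exI[of _ bs]) auto
  qed
qed

lemma weyl_coset_eq:
  "word as <#\<^bsub>lattice_perms\<^esub> weyl_subgroup \<theta> J = (\<lambda>bs. word (as @ bs)) ` {bs. set bs \<subseteq> J}"
proof -
  have "word as \<otimes>\<^bsub>lattice_perms\<^esub> word bs = word (as @ bs)" for as bs
    using bij_word[of as] bij_word[of bs] by (auto simp: BijGroup_def compose_def Bij_def)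
  then show ?thesis
    by (auto simp: l_coset_def weyl_subgroup_eq)
qed

lemma word_other: "j \<notin> set as \<Longrightarrow> word as \<beta> j = \<beta> j"
  by (induction as) auto

lemma word_commute:
  assumes "\<And>b. b \<in> set bs \<Longrightarrow> \<theta> a b = 0"
  shows "word (a # bs) = word (bs @ [a])"
  using assms
proof (induction bs)
  case (Cons b bs)
  have ab: "\<theta> a b = 0" "\<theta> b a = 0" using Cons.prems[of b] zero_sym[of a b] by simp_all
  have "refl a (refl b \<beta>) = refl b (refl a \<beta>)" for \<beta>
    by (rule ext) (use ab in \<open>simp add: simple_reflection_eq pairing_diff_right\<close>)
  moreover have "word (a # bs) = word (bs @ [a])" by (rule Cons.IH) (simp add: Cons.prems)
  then have comm: "refl a (word bs \<beta>) = word bs (refl a \<beta>)" for \<beta> by (simp add: fun_eq_iff)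
  ultimately show ?case by (intro ext) (simp add: comm)
qed simp

lemma word_fix_simple:
  assumes "\<And>b. b \<in> set bs \<Longrightarrow> \<theta> b a = 0"
  shows "word bs (\<alpha> a) = \<alpha> a"
  using assms by (induction bs) (auto simp: simple_reflection_eq)

section \<open>Length as the number of inversions\<close>

lemma weyl_length_le: "weyl_length \<theta> (word as) \<le> length as"
  unfolding weyl_length_def by (rule Least_le) auto

lemma reduced_word: "\<exists>bs. length bs = weyl_length \<theta> (word as) \<and> word bs = word as"
  unfolding weyl_length_def by (rule LeastI[of _ "length as"]) auto

lemma card_inversions: "card (Inv (word as)) = weyl_length \<theta> (word as)"
proof -
  \<comment> \<open>It suffices to treat reduced words. Their tails are reduced, and by
    \<open>exchange\<close> each new letter meets the positive case of
    \<open>inversions_Cons\<close>, contributing exactly one inversion.\<close>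
  have "card (Inv (word bs)) = length bs" if "weyl_length \<theta> (word bs) = length bs" for bs
    using that
  proof (induction bs)
    case Nil
    have "Inv (word []) = {}" using pos_not_neg by (auto simp: inversion_coroots_def)
    then show ?case by (metis card.empty list.size(3))
  next
    case (Cons b bs)
    have "weyl_length \<theta> (word bs) = length bs"
    proof (rule ccontr)
      assume "weyl_length \<theta> (word bs) \<noteq> length bs"
      then have "weyl_length \<theta> (word bs) < length bs" using weyl_length_le[of bs] by simp
      then obtain cs where "length cs < length bs" "word (b # cs) = word (b # bs)"
        using reduced_word weyl_word_Cons by metis
      then show False using Cons.prems weyl_length_le[of "b # cs"]
        by (metis length_Cons not_less_eq_eq not_less)
    qed
    moreover have "word (rev bs) (\<alpha> b) \<notin> neg"
    proof
      assume "word (rev bs) (\<alpha> b) \<in> neg"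
      then obtain cs where "length cs < length bs" "word (b # bs) = word cs" using exchange by blast
      then show False using Cons.prems weyl_length_le[of cs] by simp
    qed
    then have "word (rev bs) (\<alpha> b) \<in> pos" using coroot_dichotomy by (meson simple_in_coroots word_in_coroots)
    ultimately show ?case
      using Cons.IH inversions_Cons[of bs b] finite_inversions[of bs]
      by (metis card_insert_disjoint length_Cons)
  qed
  then show ?thesis using reduced_word by metis
qed

lemma inversions_empty: "Inv (word as) = {} \<Longrightarrow> word as = id"
  using card_inversions[of as] reduced_word[of as] by auto

text \<open>Up to sign, an inversion of \<open>word as \<circ> word (rev bs)\<close> would come from
  a coroot inverted by one of the two words but not by the other. Without inversions the product is
  the identity.\<close>

lemma inversions_inject:
  assumes "Inv (word as) = Inv (word bs)"
  shows "word as = word bs"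
proof -
  have "word as (word (rev bs) \<beta>) \<notin> neg" if \<beta>: "\<beta> \<in> pos" for \<beta>
  proof (cases "word (rev bs) \<beta> \<in> pos")
    case True
    have "word (rev bs) \<beta> \<notin> Inv (word bs)"
      using \<beta> pos_not_neg by (simp add: inversion_coroots_def)
    then have "word (rev bs) \<beta> \<notin> Inv (word as)" using assms by simp
    then show ?thesis using True unfolding inversion_coroots_def by blast
  next
    case False
    then have neg: "word (rev bs) \<beta> \<in> neg"
      using coroot_dichotomy \<beta> pos_in_coroots word_in_coroots by blast
    then have "(\<lambda>c. - word (rev bs) \<beta> c) \<in> Inv (word bs)"
      using \<beta> by (simp add: inversion_coroots_def uminus_pos_iff weyl_word_uminus uminus_neg_iff)
    then have "(\<lambda>c. - word (rev bs) \<beta> c) \<in> Inv (word as)" using assms by simp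
    then have "word as (word (rev bs) \<beta>) \<in> pos"
      by (simp add: inversion_coroots_def weyl_word_uminus uminus_neg_iff)
    then show ?thesis by (rule pos_not_neg)
  qed
  then have "Inv (word (as @ rev bs)) = {}" by (auto simp: inversion_coroots_def)
  then have "word as \<circ> word (rev bs) = id" using inversions_empty by fastforce
  then show ?thesis by (metis comp_apply id_apply word_rev_word ext)
qed

text \<open>If the support is proper, connectedness gives an edge from some \<open>b\<close> inside
  it to some \<open>a\<close> outside. Then the simple root of \<open>a\<close> pairs negatively
  with \<open>\<gamma>\<close>, so \<open>refl a\<close> raises the coefficient at \<open>a\<close>
  from 0 and changes nothing else.\<close>

lemma full_support_above:
  assumes "connected_diagram \<theta>" "\<gamma> \<in> pos"
  shows "\<exists>\<beta>\<in>pos. \<gamma> \<le> \<beta> \<and> (\<forall>c. 0 < \<beta> c)"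
  using assms(2)
proof (induction "card {c. \<gamma> c = 0}" arbitrary: \<gamma> rule: less_induct)
  case less
  show ?case
  proof (cases "\<forall>c. 0 < \<gamma> c")
    case True
    then show ?thesis using less.prems by blast
  next
    case False
    have nn: "0 \<le> \<gamma> c" for c using less.prems by (simp add: pos_coroots_def)
    obtain a0 where a0: "\<gamma> a0 = 0" using False nn by (meson antisym not_less)
    obtain b0 where b0: "\<gamma> b0 \<noteq> 0" using coroot_nonzero less.prems pos_in_coroots by blast
    have "(adjacent \<theta>)\<^sup>*\<^sup>* b0 a0" using assms(1) by (simp add: connected_diagram_def)
    then have "\<exists>b a. \<gamma> b \<noteq> 0 \<and> \<gamma> a = 0 \<and> adjacent \<theta> b a"
      using a0 by (induction rule: rtranclp_induct) (use b0 in auto)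
    then obtain b a where ba: "\<gamma> b \<noteq> 0" "\<gamma> a = 0" "adjacent \<theta> b a" by blast
    have "\<theta> a c * \<gamma> c \<le> 0" for c
      using offdiag[of a c] nn[of c] ba(2) by (cases "a = c") (auto simp: mult_nonpos_nonneg)
    moreover have "\<theta> a b * \<gamma> b < 0"
    proof -
      have "\<theta> a b < 0"
        using ba(3) zero_sym[of a b] offdiag[of a b] by (auto simp: adjacent_def less_le)
      then show ?thesis using nn[of b] ba(1) by (simp add: mult_neg_pos)
    qed
    ultimately have pr: "pairing (\<theta> a) \<gamma> < 0"
      unfolding pairing_def using sum_strict_mono_ex1[of UNIV "\<lambda>c. \<theta> a c * \<gamma> c" "\<lambda>_. 0"] by auto
    let ?\<gamma>' = "refl a \<gamma>"
    have val: "?\<gamma>' a > 0" using pr ba(2) by (simp add: simple_reflection_eq simple_coroot_def)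
    then have pos': "?\<gamma>' \<in> pos"
      using coroot_pos_if[of ?\<gamma>' a] less.prems pos_in_coroots by simp
    have le: "\<gamma> \<le> ?\<gamma>'"
      using pr by (auto simp: le_fun_def simple_reflection_eq simple_coroot_def)
    have "?\<gamma>' c = 0 \<Longrightarrow> \<gamma> c = 0" for c
      using val by (cases "c = a") auto
    moreover have "a \<in> {c. \<gamma> c = 0} - {c. ?\<gamma>' c = 0}" using val ba(2) by simp
    ultimately have "{c. ?\<gamma>' c = 0} \<subset> {c. \<gamma> c = 0}" by blast
    then have "card {c. ?\<gamma>' c = 0} < card {c. \<gamma> c = 0}" by (intro psubset_card_mono) auto
    from less.hyps[OF this pos'] le show ?thesis by (meson order_trans)
  qed
qed

end

section \<open>Minuscule posets and their weights\<close>

text \<open>The axioms are self-dual, with (UCB1) and (LCB1) exchanged. This is used both for the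
  reversed order on \<open>P\<close>, to pass from maximal to minimal elements, and for the final
  transport to the coroots.\<close>

lemma colored_minuscule_dual:
  fixes \<kappa> :: "'p \<Rightarrow> 'c::finite" and \<kappa>' :: "'q \<Rightarrow> 'c"
  assumes dyn: "dynkin_diagram \<theta>"
    and cm: "colored_minuscule \<theta> P r \<kappa>"
    and bij: "bij_betw f P Q"
    and rel: "\<And>x y. x \<in> P \<Longrightarrow> y \<in> P \<Longrightarrow> (f x, f y) \<in> s \<longleftrightarrow> (y, x) \<in> r"
    and po: "partial_order_on Q s"
    and col: "\<And>x. x \<in> P \<Longrightarrow> \<kappa>' (f x) = \<kappa> x"
  shows "colored_minuscule \<theta> Q s \<kappa>'"
proof -
  have Q: "Q = f ` P" and inj: "inj_on f P" using bij by (auto simp: bij_betw_def)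
  have eq: "f x = f y \<longleftrightarrow> x = y" if "x \<in> P" "y \<in> P" for x y
    using inj that by (auto simp: inj_on_def)
  have openi: "open_interval Q s (f x) (f y) = f ` open_interval P r y x" if "x \<in> P" "y \<in> P" for x y
    using that by (auto simp: open_interval_def Q rel eq)
  have closedi: "closed_interval Q s (f x) (f y) = f ` closed_interval P r y x"
    if "x \<in> P" "y \<in> P" for x y
    using that by (auto simp: closed_interval_def Q rel)
  have cov: "covered_by P r y x" if "covered_by Q s (f x) (f y)" "x \<in> P" "y \<in> P" for x y
    using that openi by (auto simp: covered_by_def rel)
  have cc: "color_class Q \<kappa>' a = f ` color_class P \<kappa> a" for a
    by (auto simp: color_class_def Q col)
  have maxi: "maximal_elements (f ` A) s = f ` minimal_elements A r" if "A \<subseteq> P" for A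
    using that by (auto simp: maximal_elements_def minimal_elements_def rel eq subset_eq)
  have mini: "minimal_elements (f ` A) s = f ` maximal_elements A r" if "A \<subseteq> P" for A
    using that by (auto simp: maximal_elements_def minimal_elements_def rel eq subset_eq)
  have upper: "upper_adjacent \<theta> Q s \<kappa>' (f x) = f ` lower_adjacent \<theta> P r \<kappa> x" if "x \<in> P" for x
    using that by (auto simp: upper_adjacent_def lower_adjacent_def Q rel eq col)
  have lower: "lower_adjacent \<theta> Q s \<kappa>' (f x) = f ` upper_adjacent \<theta> P r \<kappa> x" if "x \<in> P" for x
    using that by (auto simp: upper_adjacent_def lower_adjacent_def Q rel eq col)
  have sums: "(\<Sum>z\<in>f ` A. - \<theta> (\<kappa>' z) a) = (\<Sum>z\<in>A. - \<theta> (\<kappa> z) a)" if "A \<subseteq> P" for A a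
    using that inj_on_subset[OF inj that]
    by (subst sum.reindex) (auto intro!: sum.cong simp: col subset_eq)
  have sub: "open_interval P r x y \<subseteq> P" "upper_adjacent \<theta> P r \<kappa> x \<subseteq> P"
    "lower_adjacent \<theta> P r \<kappa> x \<subseteq> P" "color_class P \<kappa> a \<subseteq> P" for x y a
    by (auto simp: open_interval_def upper_adjacent_def lower_adjacent_def color_class_def)
  \<comment> \<open>(NA) lists the two colors in the order of the cover, which is reversed
    here.\<close>
  have adj_sym: "adjacent \<theta> a b \<longleftrightarrow> adjacent \<theta> b a" for a b
  proof -
    have "\<theta> a b = 0 \<longleftrightarrow> \<theta> b a = 0" "a \<noteq> b \<Longrightarrow> \<theta> a b \<le> 0 \<and> \<theta> b a \<le> 0"
      using dyn by (auto simp: dynkin_diagram_def)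
    then show ?thesis by (auto simp: adjacent_def less_le)
  qed
  have "\<kappa>' ` Q = \<kappa> ` P" unfolding Q image_image using col by (rule image_cong[OF HOL.refl])
  then have "colored_poset Q s \<kappa>'"
    using cm po by (simp add: colored_minuscule_def colored_poset_def)
  moreover have "locally_finite_poset Q s"
    unfolding locally_finite_poset_def
  proof (intro ballI)
    fix u v assume "u \<in> Q" "v \<in> Q"
    then obtain x y where xy: "x \<in> P" "y \<in> P" "u = f x" "v = f y" by (auto simp: Q)
    have "finite (closed_interval P r y x)"
      using cm xy unfolding colored_minuscule_def locally_finite_poset_def by blast
    then show "finite (closed_interval Q s u v)" using xy closedi by simp
  qed
  moreover have "EC Q s \<kappa>'"
    using cm by (auto simp: colored_minuscule_def EC_def Q rel col)
  moreover have "AC \<theta> Q s \<kappa>'"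
    using cm by (auto simp: colored_minuscule_def AC_def Q rel col)
  moreover have "ICE2 \<theta> Q s \<kappa>'"
    unfolding ICE2_def
  proof (intro allI impI)
    fix a u v assume c: "consecutive Q s \<kappa>' a u v"
    then obtain x y where xy: "x \<in> P" "y \<in> P" "u = f x" "v = f y"
      by (auto simp: consecutive_def color_class_def Q)
    have "consecutive P r \<kappa> a y x"
      using c xy unfolding consecutive_def xy openi[OF xy(1,2)] cc
      by (auto simp: color_class_def rel eq col)
    then have "(\<Sum>z\<in>open_interval P r y x. - \<theta> (\<kappa> z) a) = 2"
      using cm by (simp add: colored_minuscule_def ICE2_def)
    then show "(\<Sum>z\<in>open_interval Q s u v. - \<theta> (\<kappa>' z) a) = 2"
      using xy by (simp add: openi sums sub)
  qed
  moreover have "UCB1 \<theta> Q s \<kappa>'"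
    using cm unfolding UCB1_def cc maxi[OF sub(4)]
    by (auto simp: colored_minuscule_def LCB1_def minimal_elements_def color_class_def
        upper sums sub)
  moreover have "LCB1 \<theta> Q s \<kappa>'"
    using cm unfolding LCB1_def cc mini[OF sub(4)]
    by (auto simp: colored_minuscule_def UCB1_def maximal_elements_def color_class_def
        lower sums sub)
  moreover have "NA \<theta> Q s \<kappa>'"
    unfolding NA_def
  proof (intro allI impI)
    fix u v assume c: "covered_by Q s u v"
    then obtain x y where xy: "x \<in> P" "y \<in> P" "u = f x" "v = f y"
      by (auto simp: covered_by_def Q)
    then have "adjacent \<theta> (\<kappa> y) (\<kappa> x)"
      using cov c cm by (auto simp: colored_minuscule_def NA_def)
    then show "adjacent \<theta> (\<kappa>' u) (\<kappa>' v)" using xy col adj_sym by simp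
  qed
  ultimately show ?thesis by (simp add: colored_minuscule_def)
qed

section \<open>Order theory of a finite minuscule poset\<close>

locale minuscule_poset = finite_cartan \<theta> d for \<theta> :: "'c::finite \<Rightarrow> 'c \<Rightarrow> int" and d +
  fixes P :: "'p set" and r :: "'p rel" and \<kappa> :: "'p \<Rightarrow> 'c"
  assumes conn: "connected_diagram \<theta>" and fin: "finite P" and cm: "colored_minuscule \<theta> P r \<kappa>"
begin

abbreviation le :: "'p \<Rightarrow> 'p \<Rightarrow> bool" (infix "\<preceq>" 50) where "x \<preceq> y \<equiv> (x, y) \<in> r"
abbreviation up :: "'p \<Rightarrow> 'p set" where "up \<equiv> filter_generated P r"

lemma po: "partial_order_on P r"
  using cm by (simp add: colored_minuscule_def colored_poset_def)

lemma color_surj: "\<exists>x\<in>P. \<kappa> x = a"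
proof -
  have "\<kappa> ` P = UNIV" using cm by (simp add: colored_minuscule_def colored_poset_def)
  then have "a \<in> \<kappa> ` P" by simp
  then show ?thesis by blast
qed

lemma le_refl: "x \<in> P \<Longrightarrow> x \<preceq> x"
  using po by (auto simp: partial_order_on_def preorder_on_def refl_on_def)

lemma le_trans: "x \<preceq> y \<Longrightarrow> y \<preceq> z \<Longrightarrow> x \<preceq> z"
  using po by (auto simp: partial_order_on_def preorder_on_def trans_def)

lemma le_antisym: "x \<preceq> y \<Longrightarrow> y \<preceq> x \<Longrightarrow> x = y"
  using po by (auto simp: partial_order_on_def antisym_def)

lemma le_in: "x \<preceq> y \<Longrightarrow> x \<in> P" "x \<preceq> y \<Longrightarrow> y \<in> P"
  using po by (auto simp: partial_order_on_def preorder_on_def)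

lemma adjacent_iff: "adjacent \<theta> a b \<longleftrightarrow> a \<noteq> b \<and> \<theta> a b \<noteq> 0"
  using offdiag[of a b] by (auto simp: adjacent_def less_le)

lemma cover_adjacent: "covered_by P r x y \<Longrightarrow> \<kappa> x \<noteq> \<kappa> y \<and> \<theta> (\<kappa> x) (\<kappa> y) < 0 \<and> \<theta> (\<kappa> y) (\<kappa> x) < 0"
  using cm zero_sym[of "\<kappa> x" "\<kappa> y"] offdiag[of "\<kappa> y" "\<kappa> x"]
  unfolding colored_minuscule_def NA_def adjacent_def by (smt (verit))

lemma comparable: "x \<in> P \<Longrightarrow> y \<in> P \<Longrightarrow> \<theta> (\<kappa> x) (\<kappa> y) \<noteq> 0 \<Longrightarrow> x \<preceq> y \<or> y \<preceq> x"
  using cm by (cases "\<kappa> x = \<kappa> y") (auto simp: colored_minuscule_def EC_def AC_def adjacent_iff)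

lemma finite_up: "finite (up x)"
  using fin by (simp add: filter_generated_def)

lemma up_psubset: "x \<preceq> y \<Longrightarrow> x \<noteq> y \<Longrightarrow> up y \<subset> up x"
  using le_trans le_antisym le_in le_refl unfolding filter_generated_def by blast

lemma card_up_less: "x \<preceq> y \<Longrightarrow> x \<noteq> y \<Longrightarrow> card (up y) < card (up x)"
  by (intro psubset_card_mono finite_up up_psubset)

lemma maximal_elements_nonempty:
  assumes "A \<subseteq> P" "x \<in> A"
  shows "\<exists>y\<in>maximal_elements A r. x \<preceq> y"
  using assms(2)
proof (induction "card (up x)" arbitrary: x rule: less_induct)
  case less
  show ?case
  proof (cases "x \<in> maximal_elements A r")
    case True
    then show ?thesis using less.prems assms(1) le_refl by blast
  next
    case False
    then obtain y where "y \<in> A" "x \<preceq> y" "y \<noteq> x"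
      using less.prems by (auto simp: maximal_elements_def)
    then show ?thesis using less.hyps card_up_less le_trans by metis
  qed
qed

lemma minimal_elements_nonempty:
  assumes "A \<subseteq> P" "x \<in> A"
  shows "\<exists>y\<in>minimal_elements A r. y \<preceq> x"
  using assms(2)
proof (induction "card P - card (up x)" arbitrary: x rule: less_induct)
  case less
  show ?case
  proof (cases "x \<in> minimal_elements A r")
    case True
    then show ?thesis using less.prems assms(1) le_refl by blast
  next
    case False
    then obtain y where y: "y \<in> A" "y \<preceq> x" "y \<noteq> x"
      using less.prems by (auto simp: minimal_elements_def)
    have "card (up y) \<le> card P" by (intro card_mono fin) (auto simp: filter_generated_def)
    then have "card P - card (up y) < card P - card (up x)" using card_up_less y by fastforce
    then show ?thesis using less.hyps y le_trans by metis
  qed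
qed

lemma upper_cover:
  assumes "x \<preceq> z" "x \<noteq> z"
  shows "\<exists>y. covered_by P r x y \<and> y \<preceq> z"
proof -
  let ?A = "{y \<in> P. x \<preceq> y \<and> y \<noteq> x \<and> y \<preceq> z}"
  have "z \<in> ?A" using assms le_in le_refl by auto
  then obtain y where y: "y \<in> minimal_elements ?A r"
    using minimal_elements_nonempty[of ?A z] by blast
  have "open_interval P r x y = {}"
    using y le_trans by (auto simp: minimal_elements_def open_interval_def)
  then show ?thesis using y le_in assms by (auto simp: minimal_elements_def covered_by_def)
qed

lemma lower_cover:
  assumes "z \<preceq> x" "z \<noteq> x"
  shows "\<exists>y. covered_by P r y x \<and> z \<preceq> y"
proof -
  let ?A = "{y \<in> P. y \<preceq> x \<and> y \<noteq> x \<and> z \<preceq> y}"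
  have "z \<in> ?A" using assms le_in le_refl by auto
  then obtain y where y: "y \<in> maximal_elements ?A r"
    using maximal_elements_nonempty[of ?A z] by blast
  have "open_interval P r y x = {}"
    using y le_trans by (auto simp: maximal_elements_def open_interval_def)
  then show ?thesis using y le_in assms by (auto simp: maximal_elements_def covered_by_def)
qed

section \<open>Filters, with the elements that can be added or removed\<close>

definition is_filter :: "'p set \<Rightarrow> bool" where
  "is_filter F \<longleftrightarrow> F \<subseteq> P \<and> (\<forall>x\<in>F. \<forall>y. x \<preceq> y \<longrightarrow> y \<in> F)"

definition addable :: "'p set \<Rightarrow> 'p \<Rightarrow> bool" where
  "addable F x \<longleftrightarrow> x \<in> P \<and> x \<notin> F \<and> (\<forall>y. x \<preceq> y \<longrightarrow> y \<noteq> x \<longrightarrow> y \<in> F)"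

definition removable :: "'p set \<Rightarrow> 'p \<Rightarrow> bool" where
  "removable F x \<longleftrightarrow> x \<in> F \<and> (\<forall>y\<in>F. y \<preceq> x \<longrightarrow> y = x)"

lemma is_filter_up: "is_filter (up x)"
  using le_trans le_in by (auto simp: is_filter_def filter_generated_def)

lemma is_filter_finite: "is_filter F \<Longrightarrow> finite F"
  using fin finite_subset by (auto simp: is_filter_def)

lemma insert_addable:
  assumes "is_filter F" "addable F x"
  shows "is_filter (insert x F)" "removable (insert x F) x"
  using assms by (auto simp: is_filter_def addable_def removable_def)

lemma remove_removable:
  assumes "is_filter F" "removable F x"
  shows "is_filter (F - {x})" "addable (F - {x}) x"
  using assms by (auto simp: is_filter_def addable_def removable_def)

text \<open>Not a rank: this is the value, on the simple coroot of color \<open>\<kappa> x\<close>,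
  of the sum of the simple roots of all elements weakly above \<open>x\<close>. The element
  \<open>x\<close> itself contributes 2.\<close>

definition height :: "'p \<Rightarrow> int" where
  "height x = (\<Sum>z\<in>up x. \<theta> (\<kappa> z) (\<kappa> x))"

text \<open>Passing from \<open>y\<close> down to \<open>x\<close> adds 2 for \<open>x\<close> and,
  by (ICE2), -2 for the interval. The other elements of \<open>up x - up y\<close> are incomparable
  to \<open>y\<close>, so they contribute 0.\<close>

lemma height_consecutive:
  assumes "consecutive P r \<kappa> a x y"
  shows "height x = height y"
proof -
  let ?I = "open_interval P r x y" and ?f = "\<lambda>z. \<theta> (\<kappa> z) a"
  have xy: "x \<in> P" "y \<in> P" "\<kappa> x = a" "\<kappa> y = a" "x \<preceq> y" "x \<noteq> y" "\<And>z. z \<in> ?I \<Longrightarrow> \<kappa> z \<noteq> a"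
    using assms by (auto simp: consecutive_def color_class_def open_interval_def)
  have "sum (\<lambda>z. - ?f z) ?I = 2"
    using assms cm unfolding colored_minuscule_def ICE2_def by blast
  then have "sum ?f ?I = - 2" by (simp add: sum_negf)
  moreover have "sum ?f (up x - up y) = sum ?f (insert x ?I)"
  proof (rule sum.mono_neutral_right)
    show "finite (up x - up y)" using finite_up by blast
    show "insert x ?I \<subseteq> up x - up y"
      using xy le_refl le_antisym by (auto simp: filter_generated_def open_interval_def)
    show "\<forall>z\<in>up x - up y - insert x ?I. ?f z = 0"
      using xy comparable[of _ y] by (auto simp: filter_generated_def open_interval_def dest: le_refl)
  qed
  moreover have "sum ?f (insert x ?I) = 2 + sum ?f ?I"
    using fin xy by (subst sum.insert) (auto simp: open_interval_def)
  moreover have "sum ?f (up x) = sum ?f (up x - up y) + sum ?f (up y)"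
    using up_psubset[OF xy(5,6)] finite_up by (intro sum.subset_diff) auto
  ultimately show ?thesis using xy by (simp add: height_def)
qed

lemma height_le:
  assumes "x \<preceq> y" "\<kappa> x = \<kappa> y"
  shows "height x = height y"
  using assms
proof (induction "card (up x)" arbitrary: x rule: less_induct)
  case less
  show ?case
  proof (cases "x = y")
    case False
    let ?A = "{z \<in> P. x \<preceq> z \<and> z \<noteq> x \<and> z \<preceq> y \<and> \<kappa> z = \<kappa> y}"
    have "y \<in> ?A" using less.prems False le_in le_refl by auto
    \<comment> \<open>A minimal such \<open>z\<close> is the next element of this color above
      \<open>x\<close>, so \<open>x\<close> and \<open>z\<close> are consecutive.\<close>
    then obtain z where z: "z \<in> minimal_elements ?A r"
      using minimal_elements_nonempty[of ?A y] by blast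
    then have zA: "z \<in> ?A" and zmin: "\<And>u. u \<in> ?A \<Longrightarrow> u \<preceq> z \<Longrightarrow> u = z"
      by (auto simp: minimal_elements_def)
    have "u \<preceq> y" if "u \<preceq> z" for u using that zA le_trans by blast
    then have "open_interval P r x z \<inter> color_class P \<kappa> (\<kappa> y) = {}"
      using zmin by (auto simp: open_interval_def color_class_def)
    then have "consecutive P r \<kappa> (\<kappa> y) x z"
      using less.prems zA le_in by (auto simp: consecutive_def color_class_def)
    then have "height x = height z" by (rule height_consecutive)
    also have "\<dots> = height y"
      using less.hyps[of z] z card_up_less by (auto simp: minimal_elements_def)
    finally show ?thesis .
  qed simp
qed

text \<open>By (ICE2) the height is constant on each color class, so \<open>lam\<close> does not depend on the choice
  of the element. It is the dominant weight of which every filter determines a translate \<open>\<mu> F\<close>.\<close>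

definition lam :: "'c \<Rightarrow> int" where
  "lam a = height (SOME x. x \<in> P \<and> \<kappa> x = a) - 1"

definition \<mu> :: "'p set \<Rightarrow> 'c \<Rightarrow> int" where
  "\<mu> F a = lam a - (\<Sum>z\<in>F. \<theta> (\<kappa> z) a)"

lemma lam_eq:
  assumes "x \<in> P"
  shows "lam (\<kappa> x) = height x - 1"
proof -
  define y where "y = (SOME y. y \<in> P \<and> \<kappa> y = \<kappa> x)"
  have "y \<in> P \<and> \<kappa> y = \<kappa> x" unfolding y_def by (rule someI[of _ x]) (use assms in simp)
  then have "height y = height x"
    using height_le comparable[of x y] assms by fastforce
  then show ?thesis by (simp add: lam_def y_def)
qed

text \<open>Elements of \<open>F\<close> not above \<open>x\<close> are incomparable to
  \<open>x\<close> and contribute 0, so the sum over \<open>F\<close> is \<open>height x\<close>.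
  The -1 in \<open>lam\<close> is the normalization that makes the result -1 here and, since
  inserting \<open>x\<close> subtracts 2, makes it 1 for addable elements.\<close>

lemma \<mu>_removable:
  assumes F: "is_filter F" "removable F x"
  shows "\<mu> F (\<kappa> x) = - 1"
proof -
  have x: "x \<in> P" using F by (auto simp: is_filter_def removable_def)
  have "(\<Sum>z\<in>F. \<theta> (\<kappa> z) (\<kappa> x)) = height x"
    unfolding height_def
  proof (rule sum.mono_neutral_right)
    show "finite F" using F is_filter_finite by blast
    show "up x \<subseteq> F" using F by (auto simp: filter_generated_def is_filter_def removable_def)
    show "\<forall>z\<in>F - up x. \<theta> (\<kappa> z) (\<kappa> x) = 0"
      using F x comparable[of _ x] le_refl[OF x]
      by (fastforce simp: filter_generated_def is_filter_def removable_def)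
  qed
  then show ?thesis by (simp add: \<mu>_def lam_eq[OF x])
qed

lemma \<mu>_insert:
  assumes "is_filter F" "addable F x"
  shows "\<mu> (insert x F) c = \<mu> F c - \<theta> (\<kappa> x) c"
  using assms is_filter_finite[of F] by (simp add: \<mu>_def addable_def)

lemma \<mu>_addable:
  assumes F: "is_filter F" "addable F x"
  shows "\<mu> F (\<kappa> x) = 1"
  using \<mu>_removable[OF insert_addable[OF F]] \<mu>_insert[OF F] by simp

lemma \<mu>_remove:
  assumes F: "is_filter F" "removable F x"
  shows "\<mu> (F - {x}) c = \<mu> F c + \<theta> (\<kappa> x) c"
proof -
  have "insert x (F - {x}) = F" using F by (auto simp: removable_def)
  then show ?thesis using \<mu>_insert[OF remove_removable[OF F], of c] by simp
qed

text \<open>Here \<open>\<mu> F a\<close> is 1 plus the sum over the part of \<open>?U\<close>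
  missing from \<open>F\<close>. If nothing is missing, \<open>x\<close> is addable; otherwise
  (UCB1) forces that sum to be exactly -1.\<close>

lemma \<mu>_cases_top:
  assumes F: "is_filter F" and x: "x \<in> maximal_elements (color_class P \<kappa> a) r" and
    none: "\<And>z. z \<in> F \<Longrightarrow> \<kappa> z \<noteq> a"
  shows "addable F x \<or> \<mu> F a = 0"
proof -
  let ?U = "upper_adjacent \<theta> P r \<kappa> x" and ?f = "\<lambda>z. \<theta> (\<kappa> z) a"
  have xa: "x \<in> P" "\<kappa> x = a" "x \<notin> F" using x none by (auto simp: maximal_elements_def color_class_def)
  have U: "z \<in> ?U \<longleftrightarrow> z \<in> P \<and> x \<preceq> z \<and> \<kappa> z \<noteq> a \<and> ?f z \<noteq> 0" for z
    using xa by (auto simp: upper_adjacent_def adjacent_iff)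
  have finU: "finite ?U" using fin by (simp add: upper_adjacent_def)
  have neg: "?f z \<le> - 1" if "z \<in> ?U" for z
    using that offdiag[of "\<kappa> z" a] by (simp add: U)
  have UCB: "- 1 \<le> sum ?f ?U"
    using cm x by (auto simp: colored_minuscule_def UCB1_def sum_negf)
  have "height x = sum ?f (insert x ?U)"
    unfolding height_def xa
  proof (rule sum.mono_neutral_right[OF finite_up])
    show "insert x ?U \<subseteq> up x" using xa le_refl by (auto simp: filter_generated_def U)
    show "\<forall>z\<in>up x - insert x ?U. ?f z = 0"
      using x by (auto simp: filter_generated_def U maximal_elements_def color_class_def)
  qed
  also have "\<dots> = 2 + sum ?f ?U" using finU xa by (subst sum.insert) (auto simp: U)
  finally have lam: "lam a = 1 + sum ?f ?U" using lam_eq[OF xa(1)] xa by simp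
  have "sum ?f F = sum ?f (F \<inter> ?U)"
  proof (rule sum.mono_neutral_right)
    show "\<forall>z\<in>F - F \<inter> ?U. ?f z = 0"
    proof (rule ballI, rule ccontr)
      fix z assume z: "z \<in> F - F \<inter> ?U" "?f z \<noteq> 0"
      then have zP: "z \<in> P" using F by (auto simp: is_filter_def)
      have "\<not> z \<preceq> x" using z xa F by (auto simp: is_filter_def)
      then have "x \<preceq> z" using comparable[OF zP xa(1)] z xa by auto
      then show False using z none zP by (auto simp: U)
    qed
  qed (use is_filter_finite[OF F] in auto)
  then have \<mu>: "\<mu> F a = 1 + sum ?f (?U - F)"
    using lam sum.Int_Diff[OF finU, of ?f F] by (simp add: \<mu>_def Int_commute)
  show ?thesis
  proof (cases "?U \<subseteq> F")
    case True
    \<comment> \<open>It is enough to look at the upper covers of \<open>x\<close>, which lie in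
      \<open>?U\<close> by (NA).\<close>
    have "y \<in> F" if xy: "x \<preceq> y" "y \<noteq> x" for y
    proof -
      obtain u where u: "covered_by P r x u" "u \<preceq> y" using upper_cover xy by blast
      then have "u \<in> ?U" using cover_adjacent[OF u(1)] xa by (auto simp: U covered_by_def)
      then show ?thesis using True F u by (auto simp: is_filter_def)
    qed
    then show ?thesis using xa by (simp add: addable_def)
  next
    case False
    then obtain u where u: "u \<in> ?U - F" by blast
    have "sum ?f (?U - F) = ?f u + sum ?f (?U - F - {u})" using u finU by (simp add: sum.remove)
    moreover have "sum ?f (?U - F - {u}) \<le> 0" using neg by (force intro!: sum_nonpos)
    moreover have "sum ?f (?U \<inter> F) \<le> 0" using neg by (force intro!: sum_nonpos)
    ultimately have "sum ?f (?U - F) = - 1"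
      using UCB neg[of u] u sum.Int_Diff[OF finU, of ?f F] by auto
    then show ?thesis using \<mu> by simp
  qed
qed

text \<open>If \<open>x\<close> is not removable, the part of \<open>F\<close> below
  \<open>x\<close> with adjacent color has total weight at least 1, and \<open>\<mu> F a\<close> is
  that weight minus 1. The weight is bounded by (LCB1) if \<open>x\<close> is the lowest element of
  its color in \<open>P\<close>, and by (ICE2) otherwise.\<close>

lemma \<mu>_cases_lowest:
  assumes F: "is_filter F" and x: "x \<in> minimal_elements (F \<inter> color_class P \<kappa> a) r"
  shows "(\<exists>y. addable F y \<and> \<kappa> y = a) \<or> removable F x \<or> \<mu> F a = 0"
proof (cases "removable F x")
  case notrem: False
  let ?L = "lower_adjacent \<theta> P r \<kappa> x" and ?f = "\<lambda>z. \<theta> (\<kappa> z) a"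
  have xa: "x \<in> P" "\<kappa> x = a" "x \<in> F" using x by (auto simp: minimal_elements_def color_class_def)
  have L: "z \<in> ?L \<longleftrightarrow> z \<in> P \<and> z \<preceq> x \<and> \<kappa> z \<noteq> a \<and> ?f z \<noteq> 0" for z
    using xa by (auto simp: lower_adjacent_def adjacent_iff)
  have finL: "finite ?L" using fin by (simp add: lower_adjacent_def)
  have neg: "?f z \<le> - 1" if "z \<in> ?L" for z
    using that offdiag[of "\<kappa> z" a] by (simp add: L)
  have upF: "up x \<subseteq> F" using F xa by (auto simp: is_filter_def filter_generated_def)
  have "sum ?f (F - up x) = sum ?f (F \<inter> ?L)"
  proof (rule sum.mono_neutral_right)
    show "F \<inter> ?L \<subseteq> F - up x"
      using le_antisym[of x] xa by (auto simp: lower_adjacent_def filter_generated_def)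
    show "\<forall>z\<in>F - up x - F \<inter> ?L. ?f z = 0"
    proof (rule ballI, rule ccontr)
      fix z assume z: "z \<in> F - up x - F \<inter> ?L" "?f z \<noteq> 0"
      then have zP: "z \<in> P" using F by (auto simp: is_filter_def)
      have "z \<preceq> x" using z zP xa comparable[OF zP xa(1)] by (auto simp: filter_generated_def)
      moreover from this have "\<kappa> z \<noteq> a"
        using z zP x le_refl[OF zP] by (auto simp: minimal_elements_def color_class_def filter_generated_def)
      ultimately show False using z zP by (auto simp: L)
    qed
  qed (use is_filter_finite[OF F] in auto)
  moreover have "sum ?f F = sum ?f (F - up x) + height x"
    unfolding height_def xa using upF is_filter_finite[OF F] by (intro sum.subset_diff)
  ultimately have \<mu>: "\<mu> F a = - 1 - sum ?f (F \<inter> ?L)"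
    using lam_eq[OF xa(1)] xa by (simp add: \<mu>_def)
  \<comment> \<open>Since \<open>x\<close> is not removable, \<open>F\<close> has an element
    strictly below it, hence contains a lower cover of \<open>x\<close>, whose color is adjacent by
    (NA).\<close>
  have "\<exists>u. u \<in> F \<inter> ?L"
  proof -
    obtain z where z: "z \<in> F" "z \<preceq> x" "z \<noteq> x" using notrem xa by (auto simp: removable_def)
    obtain u where u: "covered_by P r u x" "z \<preceq> u" using lower_cover z by metis
    then have "u \<in> F \<inter> ?L"
      using cover_adjacent[OF u(1)] xa z F by (auto simp: L covered_by_def is_filter_def)
    then show ?thesis by blast
  qed
  then obtain u where u: "u \<in> F \<inter> ?L" by blast
  have "sum ?f (F \<inter> ?L) = ?f u + sum ?f (F \<inter> ?L - {u})" using u finL by (simp add: sum.remove)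
  moreover have "sum ?f (F \<inter> ?L - {u}) \<le> 0" using neg by (force intro!: sum_nonpos)
  ultimately have le1: "sum ?f (F \<inter> ?L) \<le> - 1" using neg[of u] u by auto
  show ?thesis
  proof (cases "x \<in> minimal_elements (color_class P \<kappa> a) r")
    case True
    then have "- 1 \<le> sum ?f ?L"
      using cm by (auto simp: colored_minuscule_def LCB1_def sum_negf)
    moreover have "sum ?f (?L - F) \<le> 0" using neg by (force intro!: sum_nonpos)
    ultimately have "- 1 \<le> sum ?f (F \<inter> ?L)"
      using sum.Int_Diff[OF finL, of ?f F] by (simp add: Int_commute)
    then show ?thesis using \<mu> le1 by simp
  next
    case False
    \<comment> \<open>The maximal element of \<open>?A\<close> is the next element of color
      \<open>a\<close> below \<open>x\<close>. It is outside \<open>F\<close> by minimality of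
      \<open>x\<close> in \<open>F\<close>.\<close>
    let ?A = "{y \<in> P. \<kappa> y = a \<and> y \<preceq> x \<and> y \<noteq> x}"
    obtain y0 where "y0 \<in> ?A" using False xa by (auto simp: minimal_elements_def color_class_def)
    then obtain y where y: "y \<in> maximal_elements ?A r"
      using maximal_elements_nonempty[of ?A y0] by blast
    have ya: "y \<in> P" "\<kappa> y = a" "y \<preceq> x" "y \<noteq> x" using y by (auto simp: maximal_elements_def)
    have yF: "y \<notin> F" using ya x by (auto simp: minimal_elements_def color_class_def)
    let ?I = "open_interval P r y x"
    have finI: "finite ?I" using fin by (simp add: open_interval_def)
    have cons: "consecutive P r \<kappa> a y x"
      using ya y xa by (auto simp: consecutive_def color_class_def open_interval_def maximal_elements_def)
    then have "sum (\<lambda>z. - ?f z) ?I = 2"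
      using cm unfolding colored_minuscule_def ICE2_def by blast
    then have I2: "sum ?f ?I = - 2" by (simp add: sum_negf)
    have Inp: "?f z \<le> 0" if "z \<in> ?I" for z
      using that cons offdiag[of "\<kappa> z" a] by (auto simp: consecutive_def color_class_def open_interval_def)
    have sub: "F \<inter> ?L \<subseteq> ?I"
    proof
      fix z assume z: "z \<in> F \<inter> ?L"
      have "\<not> z \<preceq> y" using z F yF by (auto simp: is_filter_def)
      then have "y \<preceq> z" using comparable[of z y] z ya by (auto simp: L)
      then show "z \<in> ?I" using z xa ya yF by (auto simp: L open_interval_def)
    qed
    have split: "sum ?f ?I = sum ?f (?I - F \<inter> ?L) + sum ?f (F \<inter> ?L)"
      using sub finI by (rule sum.subset_diff)
    show ?thesis
    \<comment> \<open>The interval has total weight 2. If \<open>F\<close> carries all of it, then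
      the upper covers of \<open>y\<close> are in \<open>F\<close> and \<open>y\<close> can be
      added; otherwise \<open>F\<close> carries exactly 1 and \<open>\<mu> F a\<close>
      vanishes.\<close>
    proof (cases "sum ?f (?I - F \<inter> ?L) = 0")
      case True
      then have "\<forall>z\<in>?I - F \<inter> ?L. - ?f z = 0"
        using finI Inp by (subst sum_nonneg_eq_0_iff[symmetric]) (auto simp: sum_negf)
      then have zero: "z \<in> F" if "z \<in> ?I" "?f z \<noteq> 0" for z using that by auto
      have "z \<in> F" if yz: "y \<preceq> z" "z \<noteq> y" for z
      proof -
        obtain u where u: "covered_by P r y u" "u \<preceq> z" using upper_cover yz by blast
        have ua: "?f u \<noteq> 0" "\<kappa> u \<noteq> a" "u \<in> P" "y \<preceq> u" "u \<noteq> y"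
          using cover_adjacent[OF u(1)] u ya by (auto simp: covered_by_def)
        have "\<not> x \<preceq> u"
        proof
          assume "x \<preceq> u"
          then have "x \<in> open_interval P r y u" using ya xa ua by (auto simp: open_interval_def)
          then show False using u by (auto simp: covered_by_def)
        qed
        then have "u \<preceq> x" using comparable[of u x] ua xa by auto
        then have "u \<in> ?I" using ua xa by (auto simp: open_interval_def)
        then show ?thesis using zero ua u F by (auto simp: is_filter_def)
      qed
      then have "addable F y" using ya yF by (simp add: addable_def)
      then show ?thesis using ya by blast
    next
      case False
      moreover have "sum ?f (?I - F \<inter> ?L) \<le> 0" using Inp by (auto intro!: sum_nonpos)
      ultimately show ?thesis using split I2 le1 \<mu> by simp
    qed
  qed
qed simp

text \<open>Decided at the lowest element of color \<open>a\<close> in \<open>F\<close> or, if there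
  is none, at the highest one in \<open>P\<close>.\<close>

lemma \<mu>_cases:
  assumes F: "is_filter F"
  obtains x where "addable F x" "\<kappa> x = a" | x where "removable F x" "\<kappa> x = a" | "\<mu> F a = 0"
proof (cases "\<exists>z\<in>F. \<kappa> z = a")
  case False
  obtain x0 where "x0 \<in> color_class P \<kappa> a" using color_surj by (auto simp: color_class_def)
  then obtain x where x: "x \<in> maximal_elements (color_class P \<kappa> a) r"
    using maximal_elements_nonempty[of "color_class P \<kappa> a" x0] by (auto simp: color_class_def)
  then show ?thesis
    using \<mu>_cases_top[OF F x] False that(1,3) by (auto simp: maximal_elements_def color_class_def)
next
  case True
  then obtain z where "z \<in> F \<inter> color_class P \<kappa> a"
    using F by (auto simp: is_filter_def color_class_def)
  then obtain x where x: "x \<in> minimal_elements (F \<inter> color_class P \<kappa> a) r"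
    using minimal_elements_nonempty[of "F \<inter> color_class P \<kappa> a" z] by (auto simp: color_class_def)
  then show ?thesis
    using \<mu>_cases_lowest[OF F x] that by (auto simp: minimal_elements_def color_class_def)
qed

text \<open>The values 1, -1 and 0 make the reflection subtract, add or ignore the simple root of
  \<open>a\<close>, which is the effect of adding an element, removing one, or keeping
  \<open>F\<close>.\<close>

lemma \<mu>_reflect:
  assumes F: "is_filter F"
  shows "\<exists>F'. is_filter F' \<and> \<mu> F' = (\<lambda>c. \<mu> F c - \<mu> F a * \<theta> a c)"
proof (rule \<mu>_cases[OF F, of a])
  fix x assume "addable F x" "\<kappa> x = a"
  then show ?thesis
    using F \<mu>_insert[OF F] \<mu>_addable[OF F] insert_addable[OF F] by (intro exI[of _ "insert x F"]) auto
next
  fix x assume "removable F x" "\<kappa> x = a"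
  then show ?thesis
    using F \<mu>_remove[OF F] \<mu>_removable[OF F] remove_removable[OF F] by (intro exI[of _ "F - {x}"]) auto
next
  assume "\<mu> F a = 0"
  then show ?thesis using F by (intro exI[of _ F]) auto
qed

lemma \<mu>_range: "is_filter F \<Longrightarrow> \<mu> F a \<in> {- 1, 0, 1}"
  using \<mu>_cases[of F a] \<mu>_addable \<mu>_removable by (metis insertCI)

section \<open>Pairings with coroots and uniqueness of the extremal elements\<close>

lemma pairing_refl:
  "pairing \<nu> (refl a \<beta>) = pairing (\<lambda>c. \<nu> c - \<nu> a * \<theta> a c) \<beta>"
  by (simp add: simple_reflection_eq pairing_diff_left pairing_diff_right)

text \<open>The letters of the word move one at a time from the coroot to the weight, which stays of
  the form \<open>\<mu> F\<close>. For the empty filter this says that \<open>lam\<close> is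
  minuscule.\<close>

lemma pairing_coroot_range:
  assumes "is_filter F" "\<beta> \<in> \<Phi>"
  shows "pairing (\<mu> F) \<beta> \<in> {- 1, 0, 1}"
proof -
  obtain as a where "\<beta> = word as (\<alpha> a)" using assms(2) unfolding coroots_eq by blast
  moreover have "pairing (\<mu> F) (word as (\<alpha> a)) \<in> {- 1, 0, 1}"
    using assms(1)
  proof (induction as arbitrary: F)
    case Nil
    then show ?case using \<mu>_range by simp
  next
    case (Cons b as)
    obtain F' where "is_filter F'" "\<mu> F' = (\<lambda>c. \<mu> F c - \<mu> F b * \<theta> b c)"
      using \<mu>_reflect[OF Cons.prems] by blast
    then show ?case using Cons.IH[of F'] by (simp add: pairing_refl)
  qed
  ultimately show ?thesis by simp
qed

lemma is_filter_empty: "is_filter {}"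
  by (simp add: is_filter_def)

lemma \<mu>_empty: "\<mu> {} = lam"
  by (simp add: \<mu>_def fun_eq_iff)

lemma addable_empty: "addable {} x \<longleftrightarrow> x \<in> maximal_elements P r"
  using le_in by (auto simp: addable_def maximal_elements_def)

lemma lam_cases: "lam a = 0 \<or> (\<exists>x\<in>maximal_elements P r. \<kappa> x = a \<and> lam a = 1)"
  using \<mu>_cases[OF is_filter_empty, of a] \<mu>_addable[OF is_filter_empty]
  by (metis \<mu>_empty addable_empty removable_def empty_iff)

text \<open>Two maximal elements have different colors, and \<open>lam\<close> is 1 on both. A
  positive coroot of full support would then pair with \<open>lam\<close> to at least 2.\<close>

lemma unique_maximal_element:
  assumes "x \<in> maximal_elements P r" "y \<in> maximal_elements P r"
  shows "x = y"
proof (rule ccontr)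
  assume ne: "x \<noteq> y"
  have P: "x \<in> P" "y \<in> P" using assms by (auto simp: maximal_elements_def)
  have kne: "\<kappa> x \<noteq> \<kappa> y"
    using comparable[OF P] assms P ne by (auto simp: maximal_elements_def)
  have lam1: "lam (\<kappa> x) = 1" "lam (\<kappa> y) = 1"
    using assms \<mu>_addable[OF is_filter_empty] by (auto simp: addable_empty \<mu>_empty)
  have nn: "0 \<le> lam c" for c using lam_cases[of c] by auto
  obtain \<beta> where \<beta>: "\<beta> \<in> pos" "\<And>c. 0 < \<beta> c"
    using full_support_above[OF conn simple_pos[of "\<kappa> x"]] by blast
  have "(\<Sum>c\<in>{\<kappa> x, \<kappa> y}. lam c * \<beta> c) \<le> pairing lam \<beta>"
    unfolding pairing_def using nn \<beta>(2) by (intro sum_mono2) (auto simp: less_imp_le)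
  then have "2 \<le> pairing lam \<beta>" using kne lam1 \<beta>(2)[of "\<kappa> x"] \<beta>(2)[of "\<kappa> y"] by simp
  then show False
    using pairing_coroot_range[OF is_filter_empty pos_in_coroots[OF \<beta>(1)]] by (simp add: \<mu>_empty)
qed

lemma dynkin: "dynkin_diagram \<theta>"
  using offdiag zero_sym by (auto simp: dynkin_diagram_def)

lemma unique_minimal_element:
  assumes "x \<in> minimal_elements P r" "y \<in> minimal_elements P r"
  shows "x = y"
proof -
  \<comment> \<open>The reversed order is again minuscule, and its maximal elements are the minimal
    ones of \<open>r\<close>.\<close>
  have "colored_minuscule \<theta> P (r\<inverse>) \<kappa>"
    by (rule colored_minuscule_dual[OF dynkin cm, of id]) (use po in auto)
  then interpret dual: minuscule_poset \<theta> d P "r\<inverse>" \<kappa>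
    using conn fin by unfold_locales
  show ?thesis
    using dual.unique_maximal_element[of x y] assms
    by (simp add: maximal_elements_def minimal_elements_def)
qed

end

section \<open>Heaps and inversion sets\<close>

context minuscule_poset
begin

section \<open>Linear extensions and the words they spell\<close>

lemma linear_extension_Cons:
  assumes F: "is_filter F" and lin: "linear_extension F r (x # xs)"
  shows "is_filter (F - {x})" "addable (F - {x}) x" "linear_extension (F - {x}) r xs"
    "F = insert x (F - {x})"
proof -
  have "removable F x"
    using lin by (auto simp: linear_extension_def removable_def)
  then show "is_filter (F - {x})" "addable (F - {x}) x" using remove_removable[OF F] by auto
  show "linear_extension (F - {x}) r xs" "F = insert x (F - {x})"
    using lin by (auto simp: linear_extension_def)
qed

lemma linear_extension_exists:
  assumes "A \<subseteq> P"
  shows "\<exists>xs. linear_extension A r xs"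
  using finite_subset[OF assms fin] assms
proof (induction A rule: finite_psubset_induct)
  case (psubset A)
  show ?case
  proof (cases "A = {}")
    case True
    then show ?thesis by (intro exI[of _ "[]"]) (simp add: linear_extension_def)
  next
    case False
    then obtain x where x: "x \<in> minimal_elements A r"
      using minimal_elements_nonempty[OF psubset.prems] by blast
    then have "x \<in> A" by (simp add: minimal_elements_def)
    then obtain xs where "linear_extension (A - {x}) r xs"
      using psubset.IH[of "A - {x}"] psubset.prems by blast
    then have "linear_extension A r (x # xs)"
      using x by (auto simp: linear_extension_def minimal_elements_def)
    then show ?thesis by blast
  qed
qed

text \<open>Any two linear extensions are linked by commutations: the bottom element of the first one
  is incomparable to everything that precedes it in the second one.\<close>

lemma word_linear_extension_unique:
  assumes "A \<subseteq> P" "linear_extension A r xs" "linear_extension A r ys"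
  shows "word (map \<kappa> xs) = word (map \<kappa> ys)"
  using assms
proof (induction xs arbitrary: A ys)
  case Nil
  then show ?case by (simp add: linear_extension_def)
next
  case (Cons x xs)
  have "x \<in> set ys" using Cons.prems by (auto simp: linear_extension_def)
  then obtain us vs where ys: "ys = us @ x # vs" by (meson split_list)
  have x: "x \<in> P" using Cons.prems by (auto simp: linear_extension_def)
  have "\<theta> (\<kappa> x) (\<kappa> u) = 0" if u: "u \<in> set us" for u
  proof -
    have uA: "u \<in> A" "u \<noteq> x" using Cons.prems u by (auto simp: linear_extension_def ys)
    then have "u \<in> set xs" using Cons.prems by (auto simp: linear_extension_def)
    then have "\<not> u \<preceq> x" using Cons.prems by (auto simp: linear_extension_def)
    moreover have "\<not> x \<preceq> u"
      using Cons.prems u by (auto simp: linear_extension_def ys sorted_wrt_append)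
    ultimately show ?thesis using comparable[OF x] uA Cons.prems(1) by blast
  qed
  then have "word (\<kappa> x # map \<kappa> us) = word (map \<kappa> us @ [\<kappa> x])" by (intro word_commute) auto
  then have comm: "refl (\<kappa> x) (word (map \<kappa> us) \<beta>) = word (map \<kappa> us) (refl (\<kappa> x) \<beta>)" for \<beta>
    by (simp add: fun_eq_iff)
  have "word (map \<kappa> xs) = word (map \<kappa> (us @ vs))"
  proof (rule Cons.IH)
    show "A - {x} \<subseteq> P" using Cons.prems by blast
    show "linear_extension (A - {x}) r xs" using Cons.prems by (auto simp: linear_extension_def)
    show "linear_extension (A - {x}) r (us @ vs)"
      using Cons.prems by (auto simp: linear_extension_def ys sorted_wrt_append)
  qed
  then show ?case by (intro ext) (simp add: ys comm)
qed

lemma filter_element_eq: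
  assumes "A \<subseteq> P" "linear_extension A r xs"
  shows "filter_element \<theta> r \<kappa> A = word (map \<kappa> xs)"
  unfolding filter_element_def
  using assms word_linear_extension_unique by (intro the_equality) blast+

text \<open>The inversion gained when \<open>x\<close> is added to the elements strictly above it.
  The list is reversed because reversing a word inverts the group element.\<close>

definition \<gamma> :: "'p \<Rightarrow> 'c \<Rightarrow> int" where
  "\<gamma> x = word (rev (map \<kappa> (SOME ys. linear_extension (up x - {x}) r ys))) (\<alpha> (\<kappa> x))"

lemma up_minus: "x \<in> P \<Longrightarrow> is_filter (up x - {x}) \<and> addable (up x - {x}) x"
  using remove_removable[OF is_filter_up, of x x] le_refl le_antisym
  by (auto simp: removable_def filter_generated_def)

text \<open>Elements of \<open>F\<close> not above \<open>x\<close> are incomparable to \<open>x\<close>, so their reflections fix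
  the simple coroot of \<open>\<kappa> x\<close>.\<close>

lemma \<gamma>_eq:
  assumes F: "is_filter F" "addable F x" and xs: "linear_extension F r xs"
  shows "\<gamma> x = word (rev (map \<kappa> xs)) (\<alpha> (\<kappa> x))"
proof -
  have x: "x \<in> P" using F by (simp add: addable_def)
  have sub: "up x - {x} \<subseteq> F" using F by (auto simp: addable_def filter_generated_def)
  have FP: "F \<subseteq> P" using F by (simp add: is_filter_def)
  define ys where "ys = (SOME ys. linear_extension (up x - {x}) r ys)"
  have ys: "linear_extension (up x - {x}) r ys"
    unfolding ys_def by (rule someI_ex, rule linear_extension_exists) (use sub FP in blast)
  obtain zs where zs: "linear_extension (F - up x) r zs"
    using linear_extension_exists[of "F - up x"] FP by blast
  have xF: "x \<notin> F" using F by (simp add: addable_def)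
  have "\<not> v \<preceq> u" if "u \<in> F - up x" "v \<in> up x" for u v
    using that le_trans[of x v u] FP by (auto simp: filter_generated_def)
  then have "linear_extension F r (zs @ ys)"
    using ys zs sub xF by (auto simp: linear_extension_def sorted_wrt_append)
  then have "word (map \<kappa> xs) = word (map \<kappa> (zs @ ys))"
    using word_linear_extension_unique[OF FP xs] by blast
  then have "word (rev (map \<kappa> xs)) = word (rev (map \<kappa> (zs @ ys)))" by (rule word_rev_cong)
  moreover have "word (rev (map \<kappa> zs)) (\<alpha> (\<kappa> x)) = \<alpha> (\<kappa> x)"
  proof (rule word_fix_simple)
    fix b assume "b \<in> set (rev (map \<kappa> zs))"
    then obtain z where z: "z \<in> F" "z \<notin> up x" "b = \<kappa> z" using zs by (auto simp: linear_extension_def)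
    have "\<not> z \<preceq> x" using z F by (auto simp: is_filter_def addable_def)
    moreover have "\<not> x \<preceq> z" using z FP by (auto simp: filter_generated_def)
    ultimately show "\<theta> b (\<kappa> x) = 0" using comparable[of z x] z FP x by blast
  qed
  ultimately show ?thesis by (simp add: \<gamma>_def ys_def)
qed

end

section \<open>The color of the top element and the coroots above its simple coroot\<close>

locale topped_minuscule_poset = minuscule_poset +
  fixes t
  assumes top: "t \<in> maximal_elements P r"
begin

abbreviation j where "j \<equiv> \<kappa> t"
abbreviation \<Phi>j where "\<Phi>j \<equiv> coroot_filter \<theta> j"

lemma maximal_elements_eq: "maximal_elements P r = {t}"
  using unique_maximal_element top by blast

text \<open>Read as a weight, the right-hand side is the fundamental weight of \<open>j\<close>;
  pairing with it extracts the coefficient at \<open>j\<close>.\<close>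

lemma lam_eq_simple: "lam = \<alpha> j"
proof
  fix a
  show "lam a = \<alpha> j a"
    using lam_cases[of a] \<mu>_addable[OF is_filter_empty, of t] top
    by (auto simp: simple_coroot_def maximal_elements_eq addable_empty \<mu>_empty)
qed

lemma coroot_j: "\<beta> \<in> \<Phi> \<Longrightarrow> \<beta> j \<in> {- 1, 0, 1}"
  using pairing_coroot_range[OF is_filter_empty, of \<beta>] by (simp add: \<mu>_empty lam_eq_simple)

lemma coroot_filter_eq: "\<Phi>j = {\<beta> \<in> \<Phi>. \<beta> j = 1}"
proof
  show "\<Phi>j \<subseteq> {\<beta> \<in> \<Phi>. \<beta> j = 1}"
  proof
    fix \<beta> assume "\<beta> \<in> \<Phi>j"
    then have \<beta>: "\<beta> \<in> pos" "\<alpha> j \<le> \<beta>"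
      by (auto simp: coroot_filter_def filter_generated_def coroot_order_def)
    then have "1 \<le> \<beta> j" by (auto simp: le_fun_def simple_coroot_def dest: spec[of _ j])
    then show "\<beta> \<in> {\<beta> \<in> \<Phi>. \<beta> j = 1}" using coroot_j[of \<beta>] \<beta> pos_in_coroots by auto
  qed
  show "{\<beta> \<in> \<Phi>. \<beta> j = 1} \<subseteq> \<Phi>j"
  proof
    fix \<beta> assume "\<beta> \<in> {\<beta> \<in> \<Phi>. \<beta> j = 1}"
    then have \<beta>: "\<beta> \<in> pos" "\<beta> j = 1" using coroot_pos_if[of \<beta> j] by auto
    then have "\<alpha> j \<le> \<beta>" by (auto simp: le_fun_def simple_coroot_def pos_coroots_def)
    then show "\<beta> \<in> \<Phi>j"
      using \<beta> by (simp add: coroot_filter_def filter_generated_def coroot_order_def)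
  qed
qed

lemma coroot_filter_subset_pos: "\<Phi>j \<subseteq> pos"
  by (auto simp: coroot_filter_def filter_generated_def)

text \<open>In other words, the group element of \<open>F\<close> sends \<open>lam\<close> to
  \<open>\<mu> F\<close>: each added element reflects the weight, and the coefficient at
  \<open>j\<close> is the pairing with \<open>lam\<close>.\<close>

lemma word_rev_coeff_j:
  assumes "is_filter F" "linear_extension F r xs"
  shows "word (rev (map \<kappa> xs)) \<beta> j = pairing (\<mu> F) \<beta>"
  using assms
proof (induction xs arbitrary: F \<beta>)
  case Nil
  then show ?case by (simp add: linear_extension_def \<mu>_empty lam_eq_simple)
next
  case (Cons x xs)
  note F = linear_extension_Cons[OF Cons.prems]
  have "\<mu> F = (\<lambda>c. \<mu> (F - {x}) c - \<theta> (\<kappa> x) c)"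
    using \<mu>_insert[OF F(1,2)] F(4) by (metis ext)
  then show ?case
    using Cons.IH[OF F(1,3), of "refl (\<kappa> x) \<beta>"] \<mu>_addable[OF F(1,2)] by (simp add: pairing_refl)
qed

section \<open>The coroots \<open>\<gamma> x\<close> and the inversion set of a filter\<close>

lemma \<gamma>_in:
  assumes "x \<in> P"
  shows "\<gamma> x \<in> \<Phi>j"
proof -
  obtain xs where xs: "linear_extension (up x - {x}) r xs"
    using linear_extension_exists[of "up x - {x}"] by (auto simp: filter_generated_def)
  have "\<gamma> x j = 1"
    using word_rev_coeff_j[OF _ xs] \<mu>_addable up_minus[OF assms] \<gamma>_eq[OF _ _ xs] by simp
  moreover have "\<gamma> x \<in> \<Phi>" by (simp add: \<gamma>_def)
  ultimately show ?thesis by (simp add: coroot_filter_eq)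
qed

text \<open>Adding the bottom element \<open>x\<close> contributes \<open>\<gamma> x\<close>, which
  is positive because its coefficient at \<open>j\<close> is 1. So every letter of the word yields a
  new inversion.\<close>

lemma inversions_filter:
  assumes "is_filter F" "linear_extension F r xs"
  shows "Inv (word (map \<kappa> xs)) = \<gamma> ` F" "inj_on \<gamma> F"
proof -
  have "Inv (word (map \<kappa> xs)) = \<gamma> ` F \<and> inj_on \<gamma> F"
    using assms
  proof (induction xs arbitrary: F)
    case Nil
    have "Inv (word []) = {}" using pos_not_neg by (auto simp: inversion_coroots_def)
    then show ?case using Nil by (simp add: linear_extension_def del: weyl_word_Nil)
  next
    case (Cons x xs)
    note F = linear_extension_Cons[OF Cons.prems]
    note IH = Cons.IH[OF F(1,3)]
    have g: "\<gamma> x = word (rev (map \<kappa> xs)) (\<alpha> (\<kappa> x))" by (rule \<gamma>_eq[OF F(1-3)])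
    have "\<gamma> x \<in> pos" using F(2) \<gamma>_in coroot_filter_subset_pos by (auto simp: addable_def)
    note inv = inversions_Cons[OF this[unfolded g], folded g]
    have "Inv (word (map \<kappa> (x # xs))) = insert (\<gamma> x) (\<gamma> ` (F - {x}))"
      "\<gamma> x \<notin> \<gamma> ` (F - {x})"
      using inv IH by (simp_all del: weyl_word_Cons)
    moreover have "\<gamma> ` F = insert (\<gamma> x) (\<gamma> ` (F - {x}))" using F(4) by blast
    moreover have "inj_on \<gamma> (insert x (F - {x}))"
      using IH \<open>\<gamma> x \<notin> \<gamma> ` (F - {x})\<close> unfolding inj_on_insert by simp
    ultimately show ?case using F(4) by (metis (no_types))
  qed
  then show "Inv (word (map \<kappa> xs)) = \<gamma> ` F" "inj_on \<gamma> F" by auto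
qed

lemma filter_element_word:
  assumes "is_filter F"
  obtains xs where "linear_extension F r xs" "filter_element \<theta> r \<kappa> F = word (map \<kappa> xs)"
    "Inv (word (map \<kappa> xs)) = \<gamma> ` F"
proof -
  have "F \<subseteq> P" using assms by (simp add: is_filter_def)
  then obtain xs where "linear_extension F r xs" using linear_extension_exists by blast
  then show ?thesis using that filter_element_eq[OF \<open>F \<subseteq> P\<close>] inversions_filter(1)[OF assms] by blast
qed

lemma is_filter_P: "is_filter P"
  using le_in by (auto simp: is_filter_def)

lemma \<gamma>_image: "\<gamma> ` P = \<Phi>j"
proof
  show "\<gamma> ` P \<subseteq> \<Phi>j" using \<gamma>_in by blast
  show "\<Phi>j \<subseteq> \<gamma> ` P"
  proof
    fix \<beta> assume \<beta>: "\<beta> \<in> \<Phi>j"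
    obtain xs where xs: "linear_extension P r xs" "Inv (word (map \<kappa> xs)) = \<gamma> ` P"
      using filter_element_word[OF is_filter_P] by blast
    \<comment> \<open>Nothing can be added to \<open>P\<close>, so \<open>\<mu> P\<close> is
      antidominant.\<close>
    have "\<mu> P c \<le> 0" for c
      by (rule \<mu>_cases[OF is_filter_P, of c])
        (use \<mu>_removable[OF is_filter_P] in \<open>auto simp: addable_def\<close>)
    then have np: "pairing (\<mu> P) \<eta> \<le> 0" if "\<eta> \<in> pos" for \<eta>
      unfolding pairing_def using that
      by (auto simp: pos_coroots_def mult_nonpos_nonneg intro!: sum_nonpos)
    \<comment> \<open>The image of \<open>\<beta>\<close> pairs with \<open>\<mu> P\<close> to the
      coefficient 1, while positive coroots pair nonpositively; so \<open>\<beta>\<close> is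
      inverted.\<close>
    have "pairing (\<mu> P) (word (map \<kappa> xs) \<beta>) = \<beta> j"
      using word_rev_coeff_j[OF is_filter_P xs(1), of "word (map \<kappa> xs) \<beta>"] by simp
    then have "word (map \<kappa> xs) \<beta> \<notin> pos" using np \<beta> by (force simp: coroot_filter_eq)
    then have "word (map \<kappa> xs) \<beta> \<in> neg"
      using coroot_dichotomy[of "word (map \<kappa> xs) \<beta>"] \<beta> by (auto simp: coroot_filter_eq)
    then have "\<beta> \<in> Inv (word (map \<kappa> xs))"
      using \<beta> coroot_filter_subset_pos by (auto simp: inversion_coroots_def)
    then show "\<beta> \<in> \<gamma> ` P" using xs by simp
  qed
qed

lemma \<gamma>_inj: "inj_on \<gamma> P"
  using filter_element_word[OF is_filter_P] inversions_filter(2)[OF is_filter_P] by blast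

lemma filter_image_subset: "is_filter F \<Longrightarrow> \<gamma> ` F \<subseteq> \<Phi>j"
  using \<gamma>_image by (auto simp: is_filter_def)

text \<open>Inversions have coefficient 1 at \<open>j\<close>, so the word keeps all simple coroots
  other than \<open>\<alpha> j\<close> positive. As \<open>\<beta>\<close> and
  \<open>\<beta>'\<close> agree at \<open>j\<close>, the word preserves their order and sends
  \<open>\<beta>'\<close> below a negative coroot.\<close>

lemma filter_image_ideal:
  assumes F: "is_filter F" and \<beta>: "\<beta> \<in> \<gamma> ` F" "\<beta>' \<in> \<Phi>j" "\<beta>' \<le> \<beta>"
  shows "\<beta>' \<in> \<gamma> ` F"
proof -
  obtain xs where xs: "linear_extension F r xs" "Inv (word (map \<kappa> xs)) = \<gamma> ` F"
    using filter_element_word[OF F] by blast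
  let ?w = "word (map \<kappa> xs)"
  have \<beta>j: "\<beta> \<in> \<Phi>j" using \<beta>(1) filter_image_subset[OF F] by blast
  have simple: "?w (\<alpha> b) \<in> pos" if "b \<noteq> j" for b
  proof (rule ccontr)
    assume "?w (\<alpha> b) \<notin> pos"
    then have "\<alpha> b \<in> Inv ?w"
      using coroot_dichotomy[of "?w (\<alpha> b)"] by (auto simp: inversion_coroots_def)
    then have "\<alpha> b j = 1" using xs filter_image_subset[OF F] by (auto simp: coroot_filter_eq)
    then show False using that by (simp add: simple_coroot_def)
  qed
  have le: "?w \<beta>' c \<le> ?w \<beta> c" for c
  proof -
    have "?w \<beta>' c = (\<Sum>b\<in>UNIV. \<beta>' b * ?w (\<alpha> b) c)" by (rule fun_cong[OF weyl_word_expand])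
    also have "\<dots> \<le> (\<Sum>b\<in>UNIV. \<beta> b * ?w (\<alpha> b) c)"
    proof (rule sum_mono)
      fix b
      show "\<beta>' b * ?w (\<alpha> b) c \<le> \<beta> b * ?w (\<alpha> b) c"
      proof (cases "b = j")
        case True
        then show ?thesis using \<beta>j \<beta>(2) by (auto simp: coroot_filter_eq)
      next
        case False
        then show ?thesis
          using simple[OF False] \<beta>(3) by (intro mult_right_mono) (auto simp: pos_coroots_def le_fun_def)
      qed
    qed
    also have "\<dots> = ?w \<beta> c" by (rule fun_cong[OF weyl_word_expand, symmetric])
    finally show ?thesis .
  qed
  have "\<beta> \<in> Inv ?w" using \<beta>(1) xs by simp
  then have "?w \<beta> c \<le> 0" for c by (simp add: inversion_coroots_def neg_coroots_def)
  then have "?w \<beta>' c \<le> 0" for c using le[of c] order_trans by blast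
  moreover have "?w \<beta>' \<in> \<Phi>" using \<beta>(2) by (simp add: coroot_filter_eq)
  ultimately have "\<beta>' \<in> Inv ?w"
    using \<beta>(2) coroot_filter_subset_pos by (auto simp: inversion_coroots_def neg_coroots_def)
  then show ?thesis using xs by simp
qed

section \<open>Order reversal by \<open>\<gamma>\<close>\<close>

lemma word_rev_pos:
  assumes F: "is_filter F" "linear_extension F r xs" and \<beta>: "\<beta> \<in> pos"
    and zero: "word (rev (map \<kappa> xs)) \<beta> j = 0"
  shows "word (rev (map \<kappa> xs)) \<beta> \<in> pos"
proof (rule ccontr)
  \<comment> \<open>If the image of \<open>\<beta>\<close> were negative, then
    \<open>?\<eta>\<close> would be an inversion of the word of \<open>F\<close>, and those have
    coefficient 1 at \<open>j\<close>.\<close>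
  let ?\<eta> = "\<lambda>c. - word (rev (map \<kappa> xs)) \<beta> c"
  assume "word (rev (map \<kappa> xs)) \<beta> \<notin> pos"
  then have "?\<eta> \<in> pos"
    unfolding uminus_pos_iff using coroot_dichotomy[OF word_in_coroots[OF pos_in_coroots[OF \<beta>]]] by blast
  moreover have "word (map \<kappa> xs) ?\<eta> \<in> neg" using \<beta> by (simp add: weyl_word_uminus uminus_neg_iff)
  ultimately have "?\<eta> \<in> \<gamma> ` F" using inversions_filter(1)[OF F] by (auto simp: inversion_coroots_def)
  then have "?\<eta> j = 1" using filter_image_subset[OF F(1)] by (auto simp: coroot_filter_eq)
  then show False using zero by simp
qed

text \<open>Adding \<open>y\<close> and then \<open>x\<close> to \<open>?F\<close> expresses
  \<open>\<gamma> x - \<gamma> y\<close> through images under \<open>?u\<close>. This difference has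
  coefficient 0 at \<open>j\<close>, so \<open>word_rev_pos\<close> applies once it is recognized as
  the image of a positive coroot.\<close>

lemma \<gamma>_cover:
  assumes cov: "covered_by P r x y"
  shows "\<gamma> y \<le> \<gamma> x"
proof -
  let ?a = "\<kappa> x" and ?b = "\<kappa> y" and ?F = "up x - {x, y}"
  have xy: "x \<in> P" "y \<in> P" "x \<preceq> y" "x \<noteq> y" and no: "\<And>z. x \<preceq> z \<Longrightarrow> z \<preceq> y \<Longrightarrow> z = x \<or> z = y"
    using cov le_in by (auto simp: covered_by_def open_interval_def)
  have F1: "is_filter (up x - {x})" "addable (up x - {x}) x" using up_minus xy by auto
  have "removable (up x - {x}) y" using xy no by (auto simp: removable_def filter_generated_def)
  moreover have "up x - {x} - {y} = ?F" by blast
  ultimately have F: "is_filter ?F" "addable ?F y" using remove_removable[OF F1(1)] by metis+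
  obtain xs where xs: "linear_extension ?F r xs"
    using linear_extension_exists[of ?F] F(1) unfolding is_filter_def by blast
  have "\<not> v \<preceq> y" if "v \<in> ?F" for v using that no by (auto simp: filter_generated_def)
  moreover have "up x - {x} = insert y ?F" using xy by (auto simp: filter_generated_def)
  ultimately have ys: "linear_extension (up x - {x}) r (y # xs)"
    using xs by (auto simp: linear_extension_def)
  let ?u = "word (rev (map \<kappa> xs))"
  have gy: "\<gamma> y = ?u (\<alpha> ?b)" by (rule \<gamma>_eq[OF F xs])
  have gx: "\<gamma> x c = ?u (\<alpha> ?a) c - \<theta> ?b ?a * \<gamma> y c" for c
    unfolding \<gamma>_eq[OF F1 ys] gy by (simp add: simple_reflection_eq[of \<theta> ?b] weyl_word_diff)
  have j1: "\<gamma> x j = 1" "\<gamma> y j = 1" using \<gamma>_in xy by (auto simp: coroot_filter_eq)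
  have uj: "?u (\<alpha> ?a) j \<in> {- 1, 0, 1}" by (intro coroot_j) simp
  have ba: "\<theta> ?b ?a < 0" "\<theta> ?a ?b < 0" "?a \<noteq> ?b" using cover_adjacent[OF cov] by auto
  \<comment> \<open>At \<open>j\<close> the formula \<open>gx\<close> reads: the coefficient of
    \<open>?u (\<alpha> ?a)\<close> is \<open>1 + \<theta> ?b ?a\<close>, and it lies between -1 and
    1.\<close>
  then consider "\<theta> ?b ?a = - 1" "?u (\<alpha> ?a) j = 0" | "\<theta> ?b ?a = - 2" "?u (\<alpha> ?a) j = - 1"
    using gx[of j] j1 uj by auto
  then show ?thesis
  proof cases
    case 1
    then have "?u (\<alpha> ?a) \<in> pos" using word_rev_pos[OF F(1) xs] by simp
    then show ?thesis using gx 1 by (simp add: le_fun_def pos_coroots_def)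
  next
    case 2
    \<comment> \<open>Now \<open>\<gamma> x - \<gamma> y\<close> is the image of
      \<open>?\<delta>\<close>, the sum of the two simple coroots. Its norm is positive, which makes
      \<open>?a\<close> strictly longer than \<open>?b\<close> and forces
      \<open>\<theta> ?a ?b = - 1\<close>; hence \<open>?\<delta>\<close> is a reflected simple
      coroot.\<close>
    let ?\<delta> = "\<lambda>c. \<alpha> ?a c - (- 1) * \<alpha> ?b c"
    have sym: "d ?a * \<theta> ?a ?b = - 2 * d ?b" using d_sym[of ?a ?b] 2 by simp
    have "0 < form ?\<delta> ?\<delta>"
      by (rule form_pos) (use ba in \<open>auto simp: fun_eq_iff simple_coroot_def intro!: exI[of _ ?a]\<close>)
    also have "form ?\<delta> ?\<delta> = 2 * d ?a + 2 * (d ?a * \<theta> ?a ?b) + 2 * d ?b"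
      unfolding form_diff_left form_diff_right form_simple_left using d_sym[of ?a ?b] by simp
    finally have "d ?b < d ?a" using sym by simp
    then have "d ?a * \<theta> ?a ?b > d ?a * (- 2)" using sym by simp
    then have "real_of_int (\<theta> ?a ?b) > - 2" using d_pos[of ?a] mult_less_cancel_left_pos by blast
    then have ab: "\<theta> ?a ?b = - 1" using ba by linarith
    then have "?\<delta> = refl ?a (\<alpha> ?b)" by (simp add: simple_reflection_eq fun_eq_iff)
    moreover have "\<alpha> ?b \<noteq> \<alpha> ?a" using ba(3) by (metis simple_coroot_def zero_neq_one)
    ultimately have \<delta>: "?\<delta> \<in> pos" using refl_pos[OF simple_pos] by metis
    have u\<delta>: "?u ?\<delta> = (\<lambda>c. ?u (\<alpha> ?a) c + \<gamma> y c)" unfolding weyl_word_diff gy by simp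
    then have "?u ?\<delta> \<in> pos" using word_rev_pos[OF F(1) xs \<delta>] 2 j1 by simp
    then have nn: "0 \<le> ?u (\<alpha> ?a) c + \<gamma> y c" for c unfolding u\<delta> by (simp add: pos_coroots_def)
    have "\<gamma> y c \<le> \<gamma> x c" for c using nn[of c] gx[of c] 2 by simp
    then show ?thesis by (simp add: le_fun_def)
  qed
qed

lemma \<gamma>_antimono: "x \<preceq> y \<Longrightarrow> \<gamma> y \<le> \<gamma> x"
proof (induction "card (up x)" arbitrary: x rule: less_induct)
  case less
  show ?case
  proof (cases "x = y")
    case False
    then obtain u where u: "covered_by P r x u" "u \<preceq> y" using upper_cover less.prems by blast
    then have "card (up u) < card (up x)" by (intro card_up_less) (auto simp: covered_by_def)
    then show ?thesis using less.hyps u \<gamma>_cover order_trans by blast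
  qed simp
qed

text \<open>The converse of monotonicity comes from the ideal property of the image of
  \<open>up y\<close>, together with injectivity.\<close>

lemma \<gamma>_le_iff:
  assumes "x \<in> P" "y \<in> P"
  shows "\<gamma> x \<le> \<gamma> y \<longleftrightarrow> y \<preceq> x"
proof
  assume "\<gamma> x \<le> \<gamma> y"
  moreover have "\<gamma> y \<in> \<gamma> ` up y" using assms le_refl by (simp add: filter_generated_def)
  ultimately have "\<gamma> x \<in> \<gamma> ` up y" using filter_image_ideal[OF is_filter_up] \<gamma>_in assms by blast
  then have "x \<in> up y" using \<gamma>_inj assms is_filter_up by (auto simp: inj_on_def is_filter_def)
  then show "y \<preceq> x" by (simp add: filter_generated_def)
qed (rule \<gamma>_antimono)

lemma coroot_order_iff: "(\<beta>, \<beta>') \<in> coroot_order A \<longleftrightarrow> \<beta> \<in> A \<and> \<beta>' \<in> A \<and> \<beta> \<le> \<beta>'"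
  by (simp add: coroot_order_def)

lemma \<gamma>_dual_isomorphism:
  assumes "A \<subseteq> P"
  shows "dual_isomorphism A r (\<gamma> ` A) (coroot_order (\<gamma> ` A)) \<gamma>"
proof -
  have inj: "inj_on \<gamma> A" using \<gamma>_inj assms inj_on_subset by blast
  then show ?thesis
    using assms \<gamma>_le_iff
    by (auto simp: dual_isomorphism_def bij_betw_def order_reversing_def coroot_order_iff
        the_inv_into_f_f subset_eq)
qed

lemma inversions_up:
  assumes "x \<in> P"
  shows "inversion_coroots \<theta> (filter_element \<theta> r \<kappa> (up x)) = \<gamma> ` up x"
    and "\<gamma> ` up x = ideal_generated \<Phi>j (coroot_order \<Phi>j) (\<gamma> x)"
proof -
  show "Inv (filter_element \<theta> r \<kappa> (up x)) = \<gamma> ` up x"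
    using filter_element_word[OF is_filter_up] by metis
  show "\<gamma> ` up x = ideal_generated \<Phi>j (coroot_order \<Phi>j) (\<gamma> x)"
    unfolding \<gamma>_image[symmetric] using assms \<gamma>_le_iff
    by (auto simp: ideal_generated_def coroot_order_iff filter_generated_def image_iff)
qed

section \<open>The bottom element: highest coroot and longest representative\<close>

lemma minimal_element:
  obtains m where "minimal_elements P r = {m}" "m \<in> P" "up m = P"
proof -
  have "t \<in> P" using top by (simp add: maximal_elements_def)
  then obtain m where m: "m \<in> minimal_elements P r" using minimal_elements_nonempty[of P t] by blast
  then have "m \<preceq> x" if "x \<in> P" for x
    using minimal_elements_nonempty[of P x] unique_minimal_element that by blast
  then show ?thesis
    using m unique_minimal_element by (intro that[of m]) (auto simp: minimal_elements_def filter_generated_def)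
qed

text \<open>Every positive coroot lies below one of full support. That one has coefficient 1 at
  \<open>j\<close>, so it belongs to \<open>\<Phi>j\<close>, where \<open>\<gamma> m\<close> is the
  top.\<close>

lemma highest_coroot:
  assumes "m \<in> P" "up m = P"
  shows "is_highest_coroot \<theta> (\<gamma> m)" "maximal_elements \<Phi>j (coroot_order \<Phi>j) = {\<gamma> m}"
proof -
  have ge: "\<beta> \<le> \<gamma> m" if \<beta>: "\<beta> \<in> \<Phi>j" for \<beta>
  proof -
    obtain x where "x \<in> P" "\<beta> = \<gamma> x" using \<beta> \<gamma>_image by blast
    then show ?thesis using \<gamma>_antimono assms(2) by (auto simp: filter_generated_def)
  qed
  have m: "\<gamma> m \<in> \<Phi>j" using \<gamma>_in assms by blast
  then have "\<gamma> m \<in> pos" using coroot_filter_subset_pos by blast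
  show "is_highest_coroot \<theta> (\<gamma> m)"
    unfolding is_highest_coroot_def
  proof (intro conjI ballI)
    show "\<gamma> m \<in> \<Phi>" using \<open>\<gamma> m \<in> pos\<close> pos_in_coroots by blast
    fix \<eta> assume "\<eta> \<in> \<Phi>"
    then consider "\<eta> \<in> pos" | "\<eta> \<in> neg" using coroot_dichotomy by blast
    then show "\<eta> \<le> \<gamma> m"
    proof cases
      case 1
      then obtain \<beta> where \<beta>: "\<beta> \<in> pos" "\<eta> \<le> \<beta>" "0 < \<beta> j" using full_support_above[OF conn] by blast
      then have "\<beta> \<in> \<Phi>j" using coroot_j[of \<beta>] pos_in_coroots by (auto simp: coroot_filter_eq)
      then show ?thesis using ge \<beta> order_trans by blast
    next
      case 2
      then have "\<eta> c \<le> \<gamma> m c" for c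
        using \<open>\<gamma> m \<in> pos\<close> order_trans[of "\<eta> c" 0] by (auto simp: neg_coroots_def pos_coroots_def)
      then show ?thesis by (simp add: le_fun_def)
    qed
  qed
  show "maximal_elements \<Phi>j (coroot_order \<Phi>j) = {\<gamma> m}"
    using m ge by (auto simp: maximal_elements_def coroot_order_iff intro: antisym)
qed

text \<open>Lengths are compared through inversion sets: that of the given element is all of
  \<open>\<Phi>j\<close>, and every minimal representative has its inversions inside
  \<open>\<Phi>j\<close>.\<close>

lemma longest_element:
  assumes m: "m \<in> P" "up m = P"
  shows "is_longest_element \<theta> (min_coset_reps \<theta> j) (filter_element \<theta> r \<kappa> (up m))"
proof -
  obtain xs where w: "filter_element \<theta> r \<kappa> (up m) = word (map \<kappa> xs)"
    "Inv (word (map \<kappa> xs)) = \<Phi>j"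
    using filter_element_word[OF is_filter_up, of m] m(2) \<gamma>_image by metis
  let ?w = "word (map \<kappa> xs)"
  have "?w \<in> min_coset_reps \<theta> j"
    unfolding min_coset_reps_def mem_Collect_eq weyl_coset_eq weyl_group_eq
  proof (intro conjI ballI)
    fix v assume "v \<in> (\<lambda>bs. word (map \<kappa> xs @ bs)) ` {bs. set bs \<subseteq> UNIV - {j}}"
    then obtain bs where v: "v = word (map \<kappa> xs @ bs)" "j \<notin> set (rev bs)" by auto
    \<comment> \<open>Letters other than \<open>j\<close> keep the coefficient 1 at
      \<open>j\<close>, so the images of inversions stay positive. This embeds the inversions of
      \<open>?w\<close> into those of \<open>v\<close>.\<close>
    have "word (rev bs) ` Inv ?w \<subseteq> Inv v"
    proof
      fix \<eta> assume "\<eta> \<in> word (rev bs) ` Inv ?w"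
      then obtain \<beta> where \<beta>: "\<beta> \<in> Inv ?w" "\<eta> = word (rev bs) \<beta>" by blast
      then have "\<beta> \<in> \<Phi>" "\<beta> j = 1" using w(2) by (auto simp: coroot_filter_eq)
      then have "\<eta> \<in> pos"
        using coroot_pos_if[of \<eta> j] word_other[OF v(2), of \<beta>] \<beta>(2) by simp
      moreover have "v \<eta> = ?w \<beta>" using \<beta> v by simp
      ultimately show "\<eta> \<in> Inv v" using \<beta>(1) by (simp add: inversion_coroots_def)
    qed
    moreover have "inj_on (word (rev bs)) (Inv ?w)"
      using bij_word bij_is_inj inj_on_subset by blast
    ultimately have "card (Inv ?w) \<le> card (Inv v)"
      using v(1) finite_inversions by (metis card_image card_mono)
    then show "weyl_length \<theta> ?w \<le> weyl_length \<theta> v" using v(1) card_inversions by metis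
  qed simp
  moreover have "weyl_length \<theta> v < weyl_length \<theta> ?w" if v: "v \<in> min_coset_reps \<theta> j" "v \<noteq> ?w" for v
  proof -
    obtain as where as: "v = word as" using v(1) by (auto simp: min_coset_reps_def weyl_group_eq)
    have simple: "word as (\<alpha> c) \<in> pos" if c: "c \<noteq> j" for c
    proof (rule ccontr)
      assume "word as (\<alpha> c) \<notin> pos"
      then have neg: "word as (\<alpha> c) \<in> neg" using coroot_dichotomy[of "word as (\<alpha> c)"] by auto
      obtain bs where bs: "length bs = weyl_length \<theta> v" "word bs = v" using reduced_word as by metis
      \<comment> \<open>Exchange is applied to the inverse of \<open>v\<close>; inverting back gives
        a shorter word for \<open>v\<close> times the reflection at \<open>c\<close>, which lies in
        the same coset.\<close>
      have "word (rev (rev bs)) (\<alpha> c) \<in> neg" using neg as bs by simp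
      then obtain cs where cs: "length cs < length bs" "word (c # rev bs) = word cs"
        using exchange by fastforce
      have "word (rev cs) = word (as @ [c])"
        using word_rev_cong[OF cs(2)] as bs(2) by simp
      moreover have "word (as @ [c]) \<in> v <#\<^bsub>lattice_perms\<^esub> weyl_subgroup \<theta> (UNIV - {j})"
        unfolding as weyl_coset_eq using c by (intro image_eqI[of _ _ "[c]"]) auto
      ultimately have "weyl_length \<theta> v \<le> weyl_length \<theta> (word (rev cs))"
        using v(1) by (auto simp: min_coset_reps_def)
      also have "\<dots> \<le> length cs" using weyl_length_le[of "rev cs"] by simp
      finally show False using cs(1) bs(1) by simp
    qed
    have "Inv v \<subseteq> \<Phi>j"
    proof
      fix \<beta> assume \<beta>: "\<beta> \<in> Inv v"
      then have b: "\<beta> \<in> pos" "word as \<beta> \<in> neg" by (auto simp: inversion_coroots_def as)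
      show "\<beta> \<in> \<Phi>j"
      proof (rule ccontr)
        assume "\<beta> \<notin> \<Phi>j"
        then have "\<beta> j \<noteq> 1" using b(1) pos_in_coroots by (simp add: coroot_filter_eq)
        moreover have "0 \<le> \<beta> j" using b(1) by (simp add: pos_coroots_def)
        ultimately have "\<beta> j = 0" using coroot_j[OF pos_in_coroots[OF b(1)]] by auto
        \<comment> \<open>With coefficient 0 at \<open>j\<close>, the image of
          \<open>\<beta>\<close> is a nonnegative combination of positive coroots, so
          \<open>\<beta>\<close> is not inverted.\<close>
        then have "0 \<le> \<beta> b * word as (\<alpha> b) c" for b c
          using simple[of b] b(1)
          by (cases "b = j") (auto simp: pos_coroots_def)
        then have "0 \<le> word as \<beta> c" for c
          unfolding fun_cong[OF weyl_word_expand[of \<theta> as \<beta>], of c] by (intro sum_nonneg)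
        then have "word as \<beta> \<in> pos"
          using b(2) by (simp add: pos_coroots_def neg_coroots_def)
        then show False using b pos_not_neg by blast
      qed
    qed
    moreover have "Inv v \<noteq> \<Phi>j" using inversions_inject[of as "map \<kappa> xs"] as v(2) w(2) by auto
    ultimately have "card (Inv v) < card (Inv ?w)"
      using finite_inversions[of "map \<kappa> xs"] w(2) by (intro psubset_card_mono) auto
    then show ?thesis using card_inversions as by metis
  qed
  ultimately show ?thesis unfolding is_longest_element_def w(1) by blast
qed

lemma partial_order_on_coroot_order: "partial_order_on A (coroot_order A)"
  by (auto simp: partial_order_on_def preorder_on_def refl_on_def trans_def antisym_def
      coroot_order_def)

end

section \<open>Transfer of the results on \<open>\<gamma>\<close> to the map given by ideal
  generators\<close>

theorem theorem9p2:
  fixes \<theta> :: "'c::finite \<Rightarrow> 'c \<Rightarrow> int"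
    and P :: "'p set" and r :: "'p rel" and \<kappa> :: "'p \<Rightarrow> 'c"
    and t :: 'p and j :: 'c
    and F :: "'p \<Rightarrow> 'p set" and w :: "'p \<Rightarrow> ('c \<Rightarrow> int) \<Rightarrow> ('c \<Rightarrow> int)"
    and \<Phi>j :: "('c \<Rightarrow> int) set" and \<psi> :: "'p \<Rightarrow> ('c \<Rightarrow> int)" and \<kappa>\<psi> :: "('c \<Rightarrow> int) \<Rightarrow> 'c"
  assumes "dynkin_diagram \<theta>" and "connected_diagram \<theta>" and "finite_type \<theta>"
    and "finite P" and "colored_minuscule \<theta> P r \<kappa>" and "connected_poset P r"
    and "t \<in> maximal_elements P r" and "j = \<kappa> t"
    and F_eq: "F = (\<lambda>x. filter_generated P r x)"
    and w_eq: "w = (\<lambda>x. filter_element \<theta> r \<kappa> (F x))"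
    and \<Phi>j_eq: "\<Phi>j = coroot_filter \<theta> j"
    and \<psi>_eq: "\<psi> = (\<lambda>x. THE \<gamma>. \<gamma> \<in> \<Phi>j \<and>
                  inversion_coroots \<theta> (w x) = ideal_generated \<Phi>j (coroot_order \<Phi>j) \<gamma>)"
    and \<kappa>\<psi>_eq: "\<kappa>\<psi> = (\<lambda>\<beta>. \<kappa> (the_inv_into P \<psi> \<beta>))"
  shows
    "maximal_elements P r = {t} \<and>
     (\<exists>\<beta>. is_highest_coroot \<theta> \<beta> \<and> maximal_elements \<Phi>j (coroot_order \<Phi>j) = {\<beta>}) \<and>
     (\<forall>x\<in>P. dual_isomorphic (F x) r
               (inversion_coroots \<theta> (w x)) (coroot_order (inversion_coroots \<theta> (w x))) \<and>
             \<psi> x \<in> \<Phi>j \<and>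
             inversion_coroots \<theta> (w x) = ideal_generated \<Phi>j (coroot_order \<Phi>j) (\<psi> x)) \<and>
     (\<exists>x. minimal_elements P r = {x}) \<and>
     (\<forall>x. minimal_elements P r = {x} \<longrightarrow>
             inversion_coroots \<theta> (w x) = \<Phi>j \<and>
             is_longest_element \<theta> (min_coset_reps \<theta> j) (w x)) \<and>
     dual_isomorphism P r \<Phi>j (coroot_order \<Phi>j) \<psi> \<and>
     colored_dual_isomorphism \<theta> id P r \<kappa> \<Phi>j (coroot_order \<Phi>j) \<kappa>\<psi> \<psi> \<and>
     colored_minuscule \<theta> \<Phi>j (coroot_order \<Phi>j) \<kappa>\<psi>"
proof -
  obtain d :: "'c \<Rightarrow> real" where d: "\<And>a. 0 < d a" "\<And>a b. d a * \<theta> a b = d b * \<theta> b a"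
    "\<And>v. v \<noteq> (\<lambda>_. 0) \<Longrightarrow> 0 < (\<Sum>a\<in>UNIV. \<Sum>b\<in>UNIV. v a * (d a * \<theta> a b) * v b)"
    using assms(3) unfolding finite_type_def by blast
  interpret topped_minuscule_poset \<theta> d P r \<kappa> t
    by unfold_locales (use assms(1-7) d in \<open>auto simp: dynkin_diagram_def\<close>)
  have \<Phi>j: "\<Phi>j = coroot_filter \<theta> (\<kappa> t)" using \<Phi>j_eq assms(8) by simp
  have inv: "inversion_coroots \<theta> (w x) = \<gamma> ` F x"
    "\<gamma> ` F x = ideal_generated \<Phi>j (coroot_order \<Phi>j) (\<gamma> x)" if "x \<in> P" for x
    using inversions_up[OF that] by (simp_all add: w_eq F_eq \<Phi>j)
  \<comment> \<open>The description defining \<open>\<psi> x\<close> has a unique solution: two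
    generators of the same principal ideal of \<open>\<Phi>j\<close> lie below each other.\<close>
  have \<psi>: "\<psi> x = \<gamma> x" if "x \<in> P" for x
    unfolding \<psi>_eq
  proof (rule the_equality)
    show x: "\<gamma> x \<in> \<Phi>j \<and>
        inversion_coroots \<theta> (w x) = ideal_generated \<Phi>j (coroot_order \<Phi>j) (\<gamma> x)"
      using inv[OF that] \<gamma>_in[OF that] \<Phi>j by simp
    fix \<beta> assume "\<beta> \<in> \<Phi>j \<and>
        inversion_coroots \<theta> (w x) = ideal_generated \<Phi>j (coroot_order \<Phi>j) \<beta>"
    then have "\<beta> \<in> \<Phi>j" "\<And>\<eta>. \<eta> \<in> \<Phi>j \<Longrightarrow> \<eta> \<le> \<beta> \<longleftrightarrow> \<eta> \<le> \<gamma> x"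
      using x by (auto simp: ideal_generated_def coroot_order_iff)
    then show "\<beta> = \<gamma> x" using x by (meson antisym order_refl)
  qed
  have bij: "bij_betw \<psi> P \<Phi>j"
  proof -
    have "bij_betw \<gamma> P \<Phi>j" using \<gamma>_inj \<gamma>_image \<Phi>j by (simp add: bij_betw_def)
    then show ?thesis using \<psi> bij_betw_cong[of P \<psi> \<gamma> \<Phi>j] by blast
  qed
  have rel: "(\<psi> x, \<psi> y) \<in> coroot_order \<Phi>j \<longleftrightarrow> (y, x) \<in> r" if "x \<in> P" "y \<in> P" for x y
    using that \<gamma>_le_iff[OF that] \<gamma>_in \<psi> \<Phi>j by (simp add: coroot_order_iff)
  have \<kappa>\<psi>: "\<kappa>\<psi> (\<psi> x) = \<kappa> x" if "x \<in> P" for x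
    using that bij by (simp add: \<kappa>\<psi>_eq bij_betw_def the_inv_into_f_f)
  have iso: "dual_isomorphism P r \<Phi>j (coroot_order \<Phi>j) \<psi>"
    using bij rel bij_betw_imp_surj_on[OF bij] bij_betw_imp_inj_on[OF bij]
    by (auto simp: dual_isomorphism_def order_reversing_def the_inv_into_f_f)
  obtain m where m: "minimal_elements P r = {m}" "m \<in> P" "up m = P" by (rule minimal_element)
  show ?thesis
  proof (intro conjI)
    show "maximal_elements P r = {t}" by (rule maximal_elements_eq)
    show "\<exists>\<beta>. is_highest_coroot \<theta> \<beta> \<and> maximal_elements \<Phi>j (coroot_order \<Phi>j) = {\<beta>}"
      using highest_coroot[OF m(2,3)] \<Phi>j by blast
    show "\<forall>x\<in>P. dual_isomorphic (F x) r
               (inversion_coroots \<theta> (w x)) (coroot_order (inversion_coroots \<theta> (w x))) \<and>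
             \<psi> x \<in> \<Phi>j \<and>
             inversion_coroots \<theta> (w x) = ideal_generated \<Phi>j (coroot_order \<Phi>j) (\<psi> x)"
    proof (intro ballI conjI)
      fix x assume x: "x \<in> P"
      have "F x \<subseteq> P" by (auto simp: F_eq filter_generated_def)
      then show "dual_isomorphic (F x) r
          (inversion_coroots \<theta> (w x)) (coroot_order (inversion_coroots \<theta> (w x)))"
        unfolding inv(1)[OF x] dual_isomorphic_def using \<gamma>_dual_isomorphism by blast
      show "\<psi> x \<in> \<Phi>j" using \<psi> \<gamma>_in x \<Phi>j by simp
      show "inversion_coroots \<theta> (w x) = ideal_generated \<Phi>j (coroot_order \<Phi>j) (\<psi> x)"
        using inv \<psi> x by simp
    qed
    show "\<exists>x. minimal_elements P r = {x}" using m by blast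
    show "\<forall>x. minimal_elements P r = {x} \<longrightarrow>
             inversion_coroots \<theta> (w x) = \<Phi>j \<and>
             is_longest_element \<theta> (min_coset_reps \<theta> j) (w x)"
      using m inv(1)[OF m(2)] longest_element[OF m(2,3)] \<gamma>_image
      by (auto simp: F_eq w_eq \<Phi>j assms(8))
    show "colored_minuscule \<theta> \<Phi>j (coroot_order \<Phi>j) \<kappa>\<psi>"
      by (rule colored_minuscule_dual[OF dynkin cm bij])
        (auto simp: rel \<kappa>\<psi> partial_order_on_coroot_order)
    show "dual_isomorphism P r \<Phi>j (coroot_order \<Phi>j) \<psi>" by (rule iso)
    then show "colored_dual_isomorphism \<theta> id P r \<kappa> \<Phi>j (coroot_order \<Phi>j) \<kappa>\<psi> \<psi>"
      using \<kappa>\<psi> by (simp add: colored_dual_isomorphism_def diagram_automorphism_def)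
  qed
qed

end
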